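(* Let $k$ be an algebraically closed field of characteristic $0$, let $G$ be a group of order $2^{m-1}$ and $L=\langle t\rangle$ a group of order $2$. For any given action $\rightharpoonup$ of $L$ on $G$ by group automorphisms, $$\left|\mathrm{H}^2(kL,k^G)\right|\le\left|\mathrm{H}^2(L,\hat G)\right|\cdot\left|M(G)^-\right|.$$
   Context: $\mathrm{Z}^2(kL,k^G)$ is the group (pointwise multiplication) of pairs $(\sigma,\tau)$, $\sigma:G\to k^\times$, $\tau:G\times G\to k^\times$, such that for all $g,u,v\in G$: $\sigma(1)=1$; $\tau(1,u)=\tau(g,1)=1$; $\sigma(t\rightharpoonup g)=\sigma(g)$; $\tau(g,u)\tau(gu,v)=\tau(g,uv)\tau(u,v)$; $\sigma(gu)=\tau(g,u)\,\tau(t\rightharpoonup g,t\rightharpoonup u)\,\sigma(g)\sigma(u)$. $\mathrm{B}^2(kL,k^G)$ is the subgroup of pairs of the form $\sigma(g)=\gamma(g)\gamma(t\rightharpoonup g)$, $\tau(g,u)=\gamma(g)^{-1}\gamma(u)^{-1}\gamma(gu)$ with $\gamma:G\to k^\times$, $\gamma(1)=1$. $\mathrm{H}^2(kL,k^G)=\mathrm{Z}^2/\mathrm{B}^2$; it classifies, up to equivalence, the abelian extensions of $kL$ by $k^G=(kG)^*$ with the given action and trivial coaction. $M(G)=\mathrm{H}^2(G,k^\times)$ is the Schur multiplier, with $L$-action $t\rightharpoonup[\alpha]=[t\rightharpoonup\alpha]$, $(t\rightharpoonup\alpha)(g,u)=\alpha(t\rightharpoonup g,t\rightharpoonup u)$,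 and $M(G)^-=\{[\alpha]\in M(G):t\rightharpoonup[\alpha]=[\alpha]^{-1}\}$. $\hat G=\mathrm{Hom}(G,k^\times)$ with $L$-action $(t\rightharpoonup\beta)(g)=\beta(t\rightharpoonup g)$. *)

theory Defs
  imports
    "HOL-Algebra.Coset"
    "HOL-Algebra.Bij"
    "HOL-Algebra.Product_Groups"
    "HOL-Algebra.Algebraic_Closure"
begin

text \<open>
  All functions are extensional (\<^term>\<open>undefined\<close> off the relevant carrier), so that functions on
  a carrier are counted once. Functions of two arguments are functions on pairs. The
  multiplicative group of the field \<open>K\<close> is \<^term>\<open>units_of K\<close>.
\<close>

subsection \<open>Second group cohomology\<close>

text \<open>
  Inhomogeneous (not necessarily normalised) 2-cocycles of a group \<open>L\<close> with values in a
  multiplicatively written abelian group \<open>A\<close>, on which \<open>L\<close> acts from the left through \<open>\<psi>\<close>.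
\<close>

definition grp_Z2 ::
  "('l, 'm) monoid_scheme \<Rightarrow> ('a, 'n) monoid_scheme \<Rightarrow> ('l \<Rightarrow> 'a \<Rightarrow> 'a) \<Rightarrow> ('l \<times> 'l \<Rightarrow> 'a) monoid"
  where "grp_Z2 L A \<psi> =
    product_group (carrier L \<times> carrier L) (\<lambda>_. A)
      \<lparr>carrier := {f \<in> carrier L \<times> carrier L \<rightarrow>\<^sub>E carrier A.
         \<forall>x \<in> carrier L. \<forall>y \<in> carrier L. \<forall>z \<in> carrier L.
           f (x, y) \<otimes>\<^bsub>A\<^esub> f (x \<otimes>\<^bsub>L\<^esub> y, z) = f (x, y \<otimes>\<^bsub>L\<^esub> z) \<otimes>\<^bsub>A\<^esub> \<psi> x (f (y, z))}\<rparr>"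

definition grp_B2 ::
  "('l, 'm) monoid_scheme \<Rightarrow> ('a, 'n) monoid_scheme \<Rightarrow> ('l \<Rightarrow> 'a \<Rightarrow> 'a) \<Rightarrow> ('l \<times> 'l \<Rightarrow> 'a) set"
  where "grp_B2 L A \<psi> =
    {(\<lambda>(x, y) \<in> carrier L \<times> carrier L. \<psi> x (c y) \<otimes>\<^bsub>A\<^esub> inv\<^bsub>A\<^esub> (c (x \<otimes>\<^bsub>L\<^esub> y)) \<otimes>\<^bsub>A\<^esub> c x)
      | c. c \<in> carrier L \<rightarrow>\<^sub>E carrier A}"

definition grp_H2 ::
  "('l, 'm) monoid_scheme \<Rightarrow> ('a, 'n) monoid_scheme \<Rightarrow> ('l \<Rightarrow> 'a \<Rightarrow> 'a) \<Rightarrow> ('l \<times> 'l \<Rightarrow> 'a) set monoid"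
  where "grp_H2 L A \<psi> = grp_Z2 L A \<psi> Mod grp_B2 L A \<psi>"

subsection \<open>The character group\<close>

definition char_group ::
  "('k, 'c) ring_scheme \<Rightarrow> ('g, 'm) monoid_scheme \<Rightarrow> ('g \<Rightarrow> 'k) monoid"
  where "char_group K G =
    product_group (carrier G) (\<lambda>_. units_of K)
      \<lparr>carrier := hom G (units_of K) \<inter> extensional (carrier G)\<rparr>"

text \<open>
  No inverse on \<open>x\<close> is needed for this to be a left action: the acting group has order 2.
\<close>

definition char_act ::
  "('g, 'm) monoid_scheme \<Rightarrow> ('l \<Rightarrow> 'g \<Rightarrow> 'g) \<Rightarrow> 'l \<Rightarrow> ('g \<Rightarrow> 'k) \<Rightarrow> 'g \<Rightarrow> 'k"
  where "char_act G \<phi> x \<beta> = (\<lambda>g \<in> carrier G. \<beta> (\<phi> x g))"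

subsection \<open>The Schur multiplier\<close>

abbreviation schur_Z2 ::
  "('k, 'c) ring_scheme \<Rightarrow> ('g, 'm) monoid_scheme \<Rightarrow> ('g \<times> 'g \<Rightarrow> 'k) monoid"
  where "schur_Z2 K G \<equiv> grp_Z2 G (units_of K) (\<lambda>_ a. a)"

abbreviation schur_B2 ::
  "('k, 'c) ring_scheme \<Rightarrow> ('g, 'm) monoid_scheme \<Rightarrow> ('g \<times> 'g \<Rightarrow> 'k) set"
  where "schur_B2 K G \<equiv> grp_B2 G (units_of K) (\<lambda>_ a. a)"

definition schur_mult ::
  "('k, 'c) ring_scheme \<Rightarrow> ('g, 'm) monoid_scheme \<Rightarrow> ('g \<times> 'g \<Rightarrow> 'k) set monoid"
  where "schur_mult K G = grp_H2 G (units_of K) (\<lambda>_ a. a)"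

definition schur_class ::
  "('k, 'c) ring_scheme \<Rightarrow> ('g, 'm) monoid_scheme \<Rightarrow> ('g \<times> 'g \<Rightarrow> 'k) \<Rightarrow> ('g \<times> 'g \<Rightarrow> 'k) set"
  where "schur_class K G \<alpha> = schur_B2 K G #>\<^bsub>schur_Z2 K G\<^esub> \<alpha>"

text \<open>Here and below \<open>s\<close> is the automorphism of \<open>G\<close> by which the generator of \<open>L\<close> acts.\<close>

definition cocycle_act ::
  "('g, 'm) monoid_scheme \<Rightarrow> ('g \<Rightarrow> 'g) \<Rightarrow> ('g \<times> 'g \<Rightarrow> 'k) \<Rightarrow> 'g \<times> 'g \<Rightarrow> 'k"
  where "cocycle_act G s \<alpha> = (\<lambda>(g, u) \<in> carrier G \<times> carrier G. \<alpha> (s g, s u))"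

definition schur_mult_minus ::
  "('k, 'c) ring_scheme \<Rightarrow> ('g, 'm) monoid_scheme \<Rightarrow> ('g \<Rightarrow> 'g) \<Rightarrow> ('g \<times> 'g \<Rightarrow> 'k) set set"
  where "schur_mult_minus K G s =
    {schur_class K G \<alpha> | \<alpha>. \<alpha> \<in> carrier (schur_Z2 K G) \<and>
       schur_class K G (cocycle_act G s \<alpha>) = inv\<^bsub>schur_mult K G\<^esub> (schur_class K G \<alpha>)}"

subsection \<open>Abelian extensions of \<open>kL\<close> by \<open>k\<^sup>G\<close>\<close>

definition ext_Z2 ::
  "('k, 'c) ring_scheme \<Rightarrow> ('g, 'm) monoid_scheme \<Rightarrow> ('g \<Rightarrow> 'g)
    \<Rightarrow> (('g \<Rightarrow> 'k) \<times> ('g \<times> 'g \<Rightarrow> 'k)) monoid"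
  where "ext_Z2 K G s =
    (product_group (carrier G) (\<lambda>_. units_of K)
       \<times>\<times> product_group (carrier G \<times> carrier G) (\<lambda>_. units_of K))
      \<lparr>carrier := {(\<sigma>, \<tau>).
         \<sigma> \<in> carrier G \<rightarrow>\<^sub>E carrier (units_of K) \<and>
         \<tau> \<in> carrier G \<times> carrier G \<rightarrow>\<^sub>E carrier (units_of K) \<and>
         \<sigma> \<one>\<^bsub>G\<^esub> = \<one>\<^bsub>K\<^esub> \<and>
         (\<forall>g \<in> carrier G. \<tau> (\<one>\<^bsub>G\<^esub>, g) = \<one>\<^bsub>K\<^esub> \<and> \<tau> (g, \<one>\<^bsub>G\<^esub>) = \<one>\<^bsub>K\<^esub>) \<and>
         (\<forall>g \<in> carrier G. \<sigma> (s g) = \<sigma> g) \<and>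
         (\<forall>g \<in> carrier G. \<forall>u \<in> carrier G. \<forall>v \<in> carrier G.
            \<tau> (g, u) \<otimes>\<^bsub>K\<^esub> \<tau> (g \<otimes>\<^bsub>G\<^esub> u, v) = \<tau> (g, u \<otimes>\<^bsub>G\<^esub> v) \<otimes>\<^bsub>K\<^esub> \<tau> (u, v)) \<and>
         (\<forall>g \<in> carrier G. \<forall>u \<in> carrier G.
            \<sigma> (g \<otimes>\<^bsub>G\<^esub> u) = \<tau> (g, u) \<otimes>\<^bsub>K\<^esub> \<tau> (s g, s u) \<otimes>\<^bsub>K\<^esub> \<sigma> g \<otimes>\<^bsub>K\<^esub> \<sigma> u)}\<rparr>"

definition ext_B2 ::
  "('k, 'c) ring_scheme \<Rightarrow> ('g, 'm) monoid_scheme \<Rightarrow> ('g \<Rightarrow> 'g)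
    \<Rightarrow> (('g \<Rightarrow> 'k) \<times> ('g \<times> 'g \<Rightarrow> 'k)) set"
  where "ext_B2 K G s =
    {((\<lambda>g \<in> carrier G. \<gamma> g \<otimes>\<^bsub>K\<^esub> \<gamma> (s g)),
      (\<lambda>(g, u) \<in> carrier G \<times> carrier G.
         inv\<^bsub>K\<^esub> (\<gamma> g) \<otimes>\<^bsub>K\<^esub> inv\<^bsub>K\<^esub> (\<gamma> u) \<otimes>\<^bsub>K\<^esub> \<gamma> (g \<otimes>\<^bsub>G\<^esub> u)))
      | \<gamma>. \<gamma> \<in> carrier G \<rightarrow>\<^sub>E carrier (units_of K) \<and> \<gamma> \<one>\<^bsub>G\<^esub> = \<one>\<^bsub>K\<^esub>}"

definition ext_H2 ::
  "('k, 'c) ring_scheme \<Rightarrow> ('g, 'm) monoid_scheme \<Rightarrow> ('g \<Rightarrow> 'g)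
    \<Rightarrow> (('g \<Rightarrow> 'k) \<times> ('g \<times> 'g \<Rightarrow> 'k)) set monoid"
  where "ext_H2 K G s = ext_Z2 K G s Mod ext_B2 K G s"

end

theory Submission
  imports Defs
begin

text \<open>
  The relation between \<open>\<sigma>\<close> and \<open>\<tau>\<close> says that \<open>\<tau> \<cdot> (t \<rightharpoonup> \<tau>)\<close> is the coboundary of \<open>\<sigma>\<inverse>\<close>, so
  \<open>(\<sigma>, \<tau>) \<mapsto> [\<tau>]\<close> maps into \<open>M(G)\<^sup>-\<close>. If \<open>[\<tau>]\<close> is trivial, then modulo \<open>B\<^sup>2\<close> one may take
  \<open>\<tau> = 1\<close>, and then \<open>\<sigma>\<close> is a \<open>t\<close>-invariant character. Such a character \<open>\<rho>\<close> is sent to the class in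
  \<open>H\<^sup>2(L, Hom(G, k\<^sup>\<times>))\<close> of the cocycle that is \<open>\<rho>\<close> at \<open>(t, t)\<close> and trivial elsewhere; if that
  class vanishes, \<open>\<rho>\<close> is a norm \<open>(t \<rightharpoonup> \<beta>) \<cdot> \<beta>\<close> and \<open>(\<rho>, 1)\<close> lies in \<open>B\<^sup>2\<close>. So every fibre has at
  most \<open>|H\<^sup>2(L, Hom(G, k\<^sup>\<times>))|\<close> elements. The Schur multiplier is finite because each class is
  represented by a cocycle with values in the roots of unity of order dividing \<open>|G|\<close>.
\<close>

subsection \<open>Counting cosets\<close>

text \<open>The function \<open>f\<close> separates cosets without having to be constant on them: a
  coset is recovered from the value of \<open>f\<close> at any of its elements. Choosing a preimage
  for each value gives a map on \<open>S\<close> whose image contains every coset.\<close>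

lemma (in group) card_rcosets_le:
  assumes "subgroup B G" and "finite S" and f: "f \<in> carrier G \<rightarrow> S"
    and eq: "\<And>a b. \<lbrakk>a \<in> carrier G; b \<in> carrier G; f a = f b\<rbrakk> \<Longrightarrow> a \<otimes> inv b \<in> B"
  shows "finite (rcosets B) \<and> card (rcosets B) \<le> card S"
proof -
  let ?g = "\<lambda>s. B #> (SOME a. a \<in> carrier G \<and> f a = s)"
  have "rcosets B \<subseteq> ?g ` S"
  proof
    fix C assume "C \<in> rcosets B"
    then obtain a where a: "a \<in> carrier G" "C = B #> a"
      by (auto simp: RCOSETS_def)
    define b where "b = (SOME b. b \<in> carrier G \<and> f b = f a)"
    have b: "b \<in> carrier G" "f b = f a"
      using someI[of "\<lambda>b. b \<in> carrier G \<and> f b = f a" a] a by (auto simp: b_def)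
    have "a \<in> B #> b"
      using subgroup.rcos_module[OF assms(1) is_group b(1) a(1)] eq[OF a(1) b(1)] b(2) by simp
    then have "C = ?g (f a)"
      using repr_independence[OF _ b(1) assms(1), of a] a(2) by (simp add: b_def)
    then show "C \<in> ?g ` S"
      using f a(1) by blast
  qed
  then show ?thesis
    using surj_card_le[OF \<open>finite S\<close>] finite_surj[OF \<open>finite S\<close>] by blast
qed

lemma (in group) rcos_eq_iff:
  assumes "subgroup B G" "a \<in> carrier G" "b \<in> carrier G"
  shows "B #> a = B #> b \<longleftrightarrow> a \<otimes> inv b \<in> B"
proof -
  have "a \<otimes> inv b \<in> B \<longleftrightarrow> a \<in> B #> b"
    using subgroup.rcos_module[OF assms(1) is_group assms(3,2)] by simp
  then show ?thesis
    using repr_independence[OF _ assms(3,1)] rcos_self[OF assms(2,1)] by auto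
qed

text \<open>Base times fibre, as a bound for the number of cosets. \<open>P\<close> is the map to
  the base, \<open>F\<close> represents modulo \<open>B\<close> the quotients of elements with the
  same \<open>P\<close>-value, and \<open>h\<close> separates \<open>F\<close> modulo
  \<open>B\<close>. Both \<open>P\<close> and \<open>h\<close> are plain functions on
  representatives, so nothing has to descend to the quotient.\<close>

lemma (in comm_group) card_rcosets_le_mult:
  assumes B: "subgroup B G" and "F \<subseteq> carrier G"
    and "finite M" and "finite N" and P: "P \<in> carrier G \<rightarrow> M" and h: "h \<in> F \<rightarrow> N"
    and P_eq: "\<And>a b. \<lbrakk>a \<in> carrier G; b \<in> carrier G; P a = P b\<rbrakk> \<Longrightarrow>
      \<exists>k \<in> F. a \<otimes> inv b \<otimes> inv k \<in> B"
    and h_eq: "\<And>k l. \<lbrakk>k \<in> F; l \<in> F; h k = h l\<rbrakk> \<Longrightarrow> k \<otimes> inv l \<in> B"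
  shows "finite (rcosets B) \<and> card (rcosets B) \<le> card M * card N"
proof -
  \<comment> \<open>This depends on \<open>a\<close> only through \<open>P a\<close>, so all
    elements of a fibre are compared with one common representative.\<close>
  define r where "r a = (SOME b. b \<in> carrier G \<and> P b = P a)" for a
  have r: "r a \<in> carrier G \<and> P (r a) = P a" if "a \<in> carrier G" for a
    unfolding r_def using that by (intro someI[of "\<lambda>b. b \<in> carrier G \<and> P b = P a" a]) simp
  have r_cong: "r a = r b" if "P a = P b" for a b
    using that by (simp add: r_def)
  \<comment> \<open>Modulo \<open>B\<close>, \<open>a\<close> is \<open>r a\<close> times the
    correction \<open>\<kappa> a\<close>. Hence the pair \<open>(P a, h (\<kappa> a))\<close>
    determines the coset of \<open>a\<close>.\<close>
  define \<kappa> where "\<kappa> a = (SOME k. k \<in> F \<and> a \<otimes> inv (r a) \<otimes> inv k \<in> B)" for a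
  have \<kappa>: "\<kappa> a \<in> F \<and> a \<otimes> inv (r a) \<otimes> inv (\<kappa> a) \<in> B" if "a \<in> carrier G" for a
    using someI_ex[OF P_eq[OF that, of "r a", unfolded Bex_def]] r[OF that] by (simp add: \<kappa>_def)
  show ?thesis
    unfolding card_cartesian_product[symmetric]
  proof (rule card_rcosets_le[OF B, where f = "\<lambda>a. (P a, h (\<kappa> a))"])
    show "finite (M \<times> N)"
      using assms by simp
    show "(\<lambda>a. (P a, h (\<kappa> a))) \<in> carrier G \<rightarrow> M \<times> N"
      using P h \<kappa> by fastforce
    fix a b assume a: "a \<in> carrier G" and b: "b \<in> carrier G"
      and eq: "(P a, h (\<kappa> a)) = (P b, h (\<kappa> b))"
    let ?r = "r a" and ?k = "\<kappa> a" and ?l = "\<kappa> b"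
    have c: "?r \<in> carrier G" "?k \<in> carrier G" "?l \<in> carrier G"
      using r \<kappa> a b assms(2) by auto
    have "r b = ?r"
      using eq by (intro r_cong) simp
    then have bB: "b \<otimes> inv ?r \<otimes> inv ?l \<in> B"
      using \<kappa>[OF b] by simp
    have aB: "a \<otimes> inv ?r \<otimes> inv ?k \<in> B"
      using \<kappa>[OF a] by simp
    have kB: "?k \<otimes> inv ?l \<in> B"
      using \<kappa>[OF a] \<kappa>[OF b] eq by (intro h_eq) auto
    \<comment> \<open>In this product of three elements of \<open>B\<close> the common
      representative and both corrections cancel, which leaves
      \<open>a \<otimes> inv b\<close>.\<close>
    have "(a \<otimes> inv ?r \<otimes> inv ?k) \<otimes> (?k \<otimes> inv ?l) \<otimes> inv (b \<otimes> inv ?r \<otimes> inv ?l) \<in> B"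
      by (rule subgroup.m_closed[OF B subgroup.m_closed[OF B aB kB] subgroup.m_inv_closed[OF B bB]])
    also have "(a \<otimes> inv ?r \<otimes> inv ?k) \<otimes> (?k \<otimes> inv ?l) \<otimes> inv (b \<otimes> inv ?r \<otimes> inv ?l)
      = (a \<otimes> inv b) \<otimes> (?r \<otimes> inv ?r) \<otimes> (?k \<otimes> inv ?k) \<otimes> (?l \<otimes> inv ?l)"
      using a b c by (simp only: inv_mult inv_inv m_ac m_closed inv_closed)
    also have "\<dots> = a \<otimes> inv b"
      using a b c by simp
    finally show "a \<otimes> inv b \<in> B" .
  qed
qed

subsection \<open>Cocycles and coboundaries\<close>

lemma (in comm_group) subgroup_imp_comm_group:
  assumes "subgroup H G"
  shows "comm_group (G\<lparr>carrier := H\<rparr>)"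
proof (rule group.group_comm_groupI)
  show "group (G\<lparr>carrier := H\<rparr>)"
    using assms by (rule subgroup_imp_group)
  fix x y assume "x \<in> carrier (G\<lparr>carrier := H\<rparr>)" "y \<in> carrier (G\<lparr>carrier := H\<rparr>)"
  then show "x \<otimes>\<^bsub>G\<lparr>carrier := H\<rparr>\<^esub> y = y \<otimes>\<^bsub>G\<lparr>carrier := H\<rparr>\<^esub> x"
    using subgroup.mem_carrier[OF assms] by (simp add: m_comm)
qed

lemma comm_group_product_group:
  assumes "\<And>i. i \<in> I \<Longrightarrow> comm_group (A i)"
  shows "comm_group (product_group I A)"
proof (rule group.group_comm_groupI)
  show "group (product_group I A)"
    using assms by (simp add: comm_group.axioms)
  fix x y assume "x \<in> carrier (product_group I A)" "y \<in> carrier (product_group I A)"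
  then show "x \<otimes>\<^bsub>product_group I A\<^esub> y = y \<otimes>\<^bsub>product_group I A\<^esub> x"
    using assms by (auto simp: PiE_iff intro!: restrict_ext comm_groupE(4))
qed

lemma comm_group_DirProd:
  assumes "comm_group A" "comm_group B"
  shows "comm_group (A \<times>\<times> B)"
proof (rule group.group_comm_groupI)
  show "group (A \<times>\<times> B)"
    using assms by (simp add: DirProd_group comm_group.axioms)
  fix x y assume "x \<in> carrier (A \<times>\<times> B)" "y \<in> carrier (A \<times>\<times> B)"
  then show "x \<otimes>\<^bsub>A \<times>\<times> B\<^esub> y = y \<otimes>\<^bsub>A \<times>\<times> B\<^esub> x"
    using comm_groupE(4)[OF assms(1)] comm_groupE(4)[OF assms(2)] by (auto simp: mult_DirProd')
qed

text \<open>The telescoping behind the identity that a coboundary is a cocycle: each bracket has the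
  shape of a value of a coboundary, and the two brackets share \<open>q\<close> with opposite
  exponents.\<close>

lemma (in comm_group) cancel_middle:
  assumes "p \<in> carrier G" "q \<in> carrier G" "r \<in> carrier G" "s \<in> carrier G" "w \<in> carrier G"
  shows "(p \<otimes> inv q \<otimes> r) \<otimes> (s \<otimes> inv w \<otimes> q) = p \<otimes> s \<otimes> inv w \<otimes> r"
proof -
  have "(p \<otimes> inv q \<otimes> r) \<otimes> (s \<otimes> inv w \<otimes> q) = (q \<otimes> inv q) \<otimes> (p \<otimes> s \<otimes> inv w \<otimes> r)"
    using assms by (simp only: m_ac m_closed inv_closed)
  then show ?thesis
    using assms by simp
qed

text \<open>The locale serves two coefficient modules: \<open>units_of K\<close> with trivial action
  of \<open>G\<close>, which gives the Schur multiplier, and the character group of \<open>G\<close>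
  with the action of the group of order two.\<close>

locale comm_group_action = L: group L + A: comm_group A
  for L :: "('l, 'm) monoid_scheme" and A :: "('a, 'n) monoid_scheme"
    and \<psi> :: "'l \<Rightarrow> 'a \<Rightarrow> 'a" +
  assumes act_hom: "x \<in> carrier L \<Longrightarrow> \<psi> x \<in> hom A A"
    and act_mult: "\<lbrakk>x \<in> carrier L; y \<in> carrier L; a \<in> carrier A\<rbrakk> \<Longrightarrow>
      \<psi> (x \<otimes>\<^bsub>L\<^esub> y) a = \<psi> x (\<psi> y a)"
begin

lemma act_closed: "\<lbrakk>x \<in> carrier L; a \<in> carrier A\<rbrakk> \<Longrightarrow> \<psi> x a \<in> carrier A"
  using act_hom hom_in_carrier by metis

lemma act_mult_right:
  "\<lbrakk>x \<in> carrier L; a \<in> carrier A; b \<in> carrier A\<rbrakk> \<Longrightarrow> \<psi> x (a \<otimes>\<^bsub>A\<^esub> b) = \<psi> x a \<otimes>\<^bsub>A\<^esub> \<psi> x b"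
  using act_hom hom_mult by metis

lemma act_inv:
  "\<lbrakk>x \<in> carrier L; a \<in> carrier A\<rbrakk> \<Longrightarrow> \<psi> x (inv\<^bsub>A\<^esub> a) = inv\<^bsub>A\<^esub> \<psi> x a"
  using group_hom.hom_inv[of A A "\<psi> x" a] act_hom A.is_group
  by (simp add: group_hom_def group_hom_axioms_def)

lemma act_one: "x \<in> carrier L \<Longrightarrow> \<psi> x \<one>\<^bsub>A\<^esub> = \<one>\<^bsub>A\<^esub>"
  using act_hom A.is_group hom_one by metis

abbreviation C2 where "C2 \<equiv> product_group (carrier L \<times> carrier L) (\<lambda>_. A)"

lemma grp_Z2_iff:
  "f \<in> carrier (grp_Z2 L A \<psi>) \<longleftrightarrow>
    f \<in> carrier L \<times> carrier L \<rightarrow>\<^sub>E carrier A \<and>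
    (\<forall>x \<in> carrier L. \<forall>y \<in> carrier L. \<forall>z \<in> carrier L.
      f (x, y) \<otimes>\<^bsub>A\<^esub> f (x \<otimes>\<^bsub>L\<^esub> y, z) = f (x, y \<otimes>\<^bsub>L\<^esub> z) \<otimes>\<^bsub>A\<^esub> \<psi> x (f (y, z)))"
  by (simp add: grp_Z2_def)

lemma grp_Z2_funcset:
  "f \<in> carrier (grp_Z2 L A \<psi>) \<Longrightarrow> f \<in> carrier L \<times> carrier L \<rightarrow>\<^sub>E carrier A"
  by (simp add: grp_Z2_iff)

lemma grp_Z2_closed:
  "\<lbrakk>f \<in> carrier (grp_Z2 L A \<psi>); x \<in> carrier L; y \<in> carrier L\<rbrakk> \<Longrightarrow> f (x, y) \<in> carrier A"
  using PiE_mem[OF grp_Z2_funcset, of f "(x, y)"] by simp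

text \<open>The cocycle identity is multiplicative in \<open>f\<close>, because \<open>A\<close> is
  abelian and each \<open>\<psi> x\<close> is a homomorphism. Cocycles thus inherit their group laws
  from the group \<open>C2\<close> of all 2-cochains.\<close>

lemma subgroup_grp_Z2: "subgroup (carrier (grp_Z2 L A \<psi>)) C2"
proof (rule group.subgroupI)
  show "group C2"
    by simp
  show "carrier (grp_Z2 L A \<psi>) \<subseteq> carrier C2"
    by (simp add: grp_Z2_iff subset_iff)
  have "(\<lambda>_ \<in> carrier L \<times> carrier L. \<one>\<^bsub>A\<^esub>) \<in> carrier (grp_Z2 L A \<psi>)"
    by (simp add: grp_Z2_iff act_one)
  then show "carrier (grp_Z2 L A \<psi>) \<noteq> {}"
    by blast
next
  fix f assume "f \<in> carrier (grp_Z2 L A \<psi>)"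
  then have f: "f \<in> carrier L \<times> carrier L \<rightarrow>\<^sub>E carrier A"
    and Z: "\<And>x y z. \<lbrakk>x \<in> carrier L; y \<in> carrier L; z \<in> carrier L\<rbrakk> \<Longrightarrow>
      f (x, y) \<otimes>\<^bsub>A\<^esub> f (x \<otimes>\<^bsub>L\<^esub> y, z) = f (x, y \<otimes>\<^bsub>L\<^esub> z) \<otimes>\<^bsub>A\<^esub> \<psi> x (f (y, z))"
    by (simp_all add: grp_Z2_iff)
  have fc: "f (x, y) \<in> carrier A" if "x \<in> carrier L" "y \<in> carrier L" for x y
    using f that by auto
  show "inv\<^bsub>C2\<^esub> f \<in> carrier (grp_Z2 L A \<psi>)"
    using f by (simp add: grp_Z2_iff fc act_inv act_closed Z A.inv_mult[symmetric] Pi_iff)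
next
  fix f g assume "f \<in> carrier (grp_Z2 L A \<psi>)" "g \<in> carrier (grp_Z2 L A \<psi>)"
  then have f: "f \<in> carrier L \<times> carrier L \<rightarrow>\<^sub>E carrier A" and g: "g \<in> carrier L \<times> carrier L \<rightarrow>\<^sub>E carrier A"
    and Zf: "\<And>x y z. \<lbrakk>x \<in> carrier L; y \<in> carrier L; z \<in> carrier L\<rbrakk> \<Longrightarrow>
      f (x, y) \<otimes>\<^bsub>A\<^esub> f (x \<otimes>\<^bsub>L\<^esub> y, z) = f (x, y \<otimes>\<^bsub>L\<^esub> z) \<otimes>\<^bsub>A\<^esub> \<psi> x (f (y, z))"
    and Zg: "\<And>x y z. \<lbrakk>x \<in> carrier L; y \<in> carrier L; z \<in> carrier L\<rbrakk> \<Longrightarrow>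
      g (x, y) \<otimes>\<^bsub>A\<^esub> g (x \<otimes>\<^bsub>L\<^esub> y, z) = g (x, y \<otimes>\<^bsub>L\<^esub> z) \<otimes>\<^bsub>A\<^esub> \<psi> x (g (y, z))"
    by (simp_all add: grp_Z2_iff)
  have c: "f (x, y) \<in> carrier A" "g (x, y) \<in> carrier A" if "x \<in> carrier L" "y \<in> carrier L" for x y
    using f g that by auto
  have "f (x, y) \<otimes>\<^bsub>A\<^esub> g (x, y) \<otimes>\<^bsub>A\<^esub> (f (x \<otimes>\<^bsub>L\<^esub> y, z) \<otimes>\<^bsub>A\<^esub> g (x \<otimes>\<^bsub>L\<^esub> y, z))
      = f (x, y \<otimes>\<^bsub>L\<^esub> z) \<otimes>\<^bsub>A\<^esub> g (x, y \<otimes>\<^bsub>L\<^esub> z) \<otimes>\<^bsub>A\<^esub> \<psi> x (f (y, z) \<otimes>\<^bsub>A\<^esub> g (y, z))"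
    if "x \<in> carrier L" "y \<in> carrier L" "z \<in> carrier L" for x y z
  proof -
    have "f (x, y) \<otimes>\<^bsub>A\<^esub> g (x, y) \<otimes>\<^bsub>A\<^esub> (f (x \<otimes>\<^bsub>L\<^esub> y, z) \<otimes>\<^bsub>A\<^esub> g (x \<otimes>\<^bsub>L\<^esub> y, z))
      = f (x, y) \<otimes>\<^bsub>A\<^esub> f (x \<otimes>\<^bsub>L\<^esub> y, z) \<otimes>\<^bsub>A\<^esub> (g (x, y) \<otimes>\<^bsub>A\<^esub> g (x \<otimes>\<^bsub>L\<^esub> y, z))"
      using that c by (simp add: A.m_ac)
    then show ?thesis
      unfolding Zf[OF that] Zg[OF that] using that c by (simp add: A.m_ac act_closed act_mult_right)
  qed
  then show "f \<otimes>\<^bsub>C2\<^esub> g \<in> carrier (grp_Z2 L A \<psi>)"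
    using c by (simp add: grp_Z2_iff Pi_iff)
qed

lemma grp_Z2_eq: "grp_Z2 L A \<psi> = C2\<lparr>carrier := carrier (grp_Z2 L A \<psi>)\<rparr>"
  by (simp add: grp_Z2_def)

lemma comm_group_grp_Z2: "comm_group (grp_Z2 L A \<psi>)"
  using comm_group.subgroup_imp_comm_group[OF comm_group_product_group subgroup_grp_Z2]
    A.comm_group_axioms grp_Z2_eq by simp

lemma mult_grp_Z2:
  "f \<otimes>\<^bsub>grp_Z2 L A \<psi>\<^esub> g = (\<lambda>p \<in> carrier L \<times> carrier L. f p \<otimes>\<^bsub>A\<^esub> g p)"
  by (simp add: grp_Z2_def)

lemma inv_grp_Z2:
  assumes "f \<in> carrier (grp_Z2 L A \<psi>)"
  shows "inv\<^bsub>grp_Z2 L A \<psi>\<^esub> f = (\<lambda>p \<in> carrier L \<times> carrier L. inv\<^bsub>A\<^esub> f p)"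
proof -
  have "inv\<^bsub>grp_Z2 L A \<psi>\<^esub> f = inv\<^bsub>C2\<^esub> f"
    using group.m_inv_consistent[OF _ subgroup_grp_Z2 assms] grp_Z2_eq by simp
  then show ?thesis
    using assms by (simp add: grp_Z2_iff)
qed

section \<open>Coboundaries as a subgroup of the cocycles\<close>

definition coboundary where
  "coboundary c = (\<lambda>(x, y) \<in> carrier L \<times> carrier L.
     \<psi> x (c y) \<otimes>\<^bsub>A\<^esub> inv\<^bsub>A\<^esub> (c (x \<otimes>\<^bsub>L\<^esub> y)) \<otimes>\<^bsub>A\<^esub> c x)"

lemma grp_B2_eq: "grp_B2 L A \<psi> = coboundary ` (carrier L \<rightarrow>\<^sub>E carrier A)"
  by (auto simp: grp_B2_def coboundary_def)

lemma coboundary_apply: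
  "\<lbrakk>x \<in> carrier L; y \<in> carrier L\<rbrakk> \<Longrightarrow>
    coboundary c (x, y) = \<psi> x (c y) \<otimes>\<^bsub>A\<^esub> inv\<^bsub>A\<^esub> (c (x \<otimes>\<^bsub>L\<^esub> y)) \<otimes>\<^bsub>A\<^esub> c x"
  by (simp add: coboundary_def)

lemma coboundary_mult:
  assumes "c \<in> carrier L \<rightarrow> carrier A" "d \<in> carrier L \<rightarrow> carrier A"
  shows "coboundary c \<otimes>\<^bsub>grp_Z2 L A \<psi>\<^esub> coboundary d = coboundary (\<lambda>x \<in> carrier L. c x \<otimes>\<^bsub>A\<^esub> d x)"
  unfolding mult_grp_Z2
proof (rule extensionalityI[where A = "carrier L \<times> carrier L"])
  fix p assume "p \<in> carrier L \<times> carrier L"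
  then obtain x y where p: "p = (x, y)" "x \<in> carrier L" "y \<in> carrier L"
    by auto
  then have c: "c x \<in> carrier A" "c y \<in> carrier A" "c (x \<otimes>\<^bsub>L\<^esub> y) \<in> carrier A"
    "d x \<in> carrier A" "d y \<in> carrier A" "d (x \<otimes>\<^bsub>L\<^esub> y) \<in> carrier A"
    using assms by auto
  with p show "(\<lambda>p\<in>carrier L \<times> carrier L. coboundary c p \<otimes>\<^bsub>A\<^esub> coboundary d p) p
      = coboundary (\<lambda>x\<in>carrier L. c x \<otimes>\<^bsub>A\<^esub> d x) p"
    by (simp add: coboundary_apply act_closed act_mult_right A.inv_mult A.m_ac)
qed (auto simp: coboundary_def)

text \<open>On the left of the cocycle identity the two values of \<open>c\<close> at the product of
  \<open>x\<close> and \<open>y\<close> cancel, on the right those of \<open>\<psi> x\<close>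
  applied to \<open>c\<close> at the product of \<open>y\<close> and \<open>z\<close>. The same four
  factors remain on both sides, by the action law.\<close>

lemma coboundary_in_grp_Z2:
  assumes "c \<in> carrier L \<rightarrow> carrier A"
  shows "coboundary c \<in> carrier (grp_Z2 L A \<psi>)"
  unfolding grp_Z2_iff
proof (intro conjI ballI)
  have c: "c x \<in> carrier A" if "x \<in> carrier L" for x
    using assms that by auto
  then show "coboundary c \<in> carrier L \<times> carrier L \<rightarrow>\<^sub>E carrier A"
    using act_closed by (auto simp: coboundary_def)
  fix x y z assume xyz: "x \<in> carrier L" "y \<in> carrier L" "z \<in> carrier L"
  have 1: "coboundary c (x, y) \<otimes>\<^bsub>A\<^esub> coboundary c (x \<otimes>\<^bsub>L\<^esub> y, z)
     = \<psi> x (c y) \<otimes>\<^bsub>A\<^esub> \<psi> x (\<psi> y (c z)) \<otimes>\<^bsub>A\<^esub> inv\<^bsub>A\<^esub> (c (x \<otimes>\<^bsub>L\<^esub> y \<otimes>\<^bsub>L\<^esub> z)) \<otimes>\<^bsub>A\<^esub> c x"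
    using xyz c by (simp add: coboundary_apply A.cancel_middle act_closed act_mult)
  have "coboundary c (x, y \<otimes>\<^bsub>L\<^esub> z) \<otimes>\<^bsub>A\<^esub> \<psi> x (coboundary c (y, z))
     = \<psi> x (coboundary c (y, z)) \<otimes>\<^bsub>A\<^esub> coboundary c (x, y \<otimes>\<^bsub>L\<^esub> z)"
    using xyz c by (simp add: coboundary_apply act_closed A.m_comm)
  also have "\<dots> = (\<psi> x (\<psi> y (c z)) \<otimes>\<^bsub>A\<^esub> inv\<^bsub>A\<^esub> \<psi> x (c (y \<otimes>\<^bsub>L\<^esub> z)) \<otimes>\<^bsub>A\<^esub> \<psi> x (c y)) \<otimes>\<^bsub>A\<^esub>
      (c x \<otimes>\<^bsub>A\<^esub> inv\<^bsub>A\<^esub> (c (x \<otimes>\<^bsub>L\<^esub> y \<otimes>\<^bsub>L\<^esub> z)) \<otimes>\<^bsub>A\<^esub> \<psi> x (c (y \<otimes>\<^bsub>L\<^esub> z)))"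
    using xyz c by (simp add: coboundary_apply act_closed act_mult_right act_inv A.m_ac L.m_assoc)
  also have "\<dots> = \<psi> x (\<psi> y (c z)) \<otimes>\<^bsub>A\<^esub> c x \<otimes>\<^bsub>A\<^esub> inv\<^bsub>A\<^esub> (c (x \<otimes>\<^bsub>L\<^esub> y \<otimes>\<^bsub>L\<^esub> z)) \<otimes>\<^bsub>A\<^esub> \<psi> x (c y)"
    using xyz c by (simp add: act_closed A.cancel_middle)
  finally show "coboundary c (x, y) \<otimes>\<^bsub>A\<^esub> coboundary c (x \<otimes>\<^bsub>L\<^esub> y, z)
      = coboundary c (x, y \<otimes>\<^bsub>L\<^esub> z) \<otimes>\<^bsub>A\<^esub> \<psi> x (coboundary c (y, z))"
    unfolding 1 using xyz c by (simp add: act_closed A.m_ac)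
qed

lemma subgroup_grp_B2: "subgroup (grp_B2 L A \<psi>) (grp_Z2 L A \<psi>)"
proof -
  interpret Z: comm_group "grp_Z2 L A \<psi>"
    by (rule comm_group_grp_Z2)
  show ?thesis
  proof (rule Z.subgroupI)
    show "grp_B2 L A \<psi> \<subseteq> carrier (grp_Z2 L A \<psi>)"
      using coboundary_in_grp_Z2 by (auto simp: grp_B2_eq PiE_def)
    have "(\<lambda>_ \<in> carrier L. \<one>\<^bsub>A\<^esub>) \<in> carrier L \<rightarrow>\<^sub>E carrier A"
      by simp
    then show "grp_B2 L A \<psi> \<noteq> {}"
      unfolding grp_B2_eq by blast
  next
    fix f assume "f \<in> grp_B2 L A \<psi>"
    then obtain c where c: "c \<in> carrier L \<rightarrow>\<^sub>E carrier A" "f = coboundary c"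
      by (auto simp: grp_B2_eq)
    \<comment> \<open>\<open>coboundary\<close> is multiplicative, so the pointwise inverse of
      \<open>c\<close> yields the inverse coboundary.\<close>
    let ?d = "\<lambda>x \<in> carrier L. inv\<^bsub>A\<^esub> c x"
    have d: "?d \<in> carrier L \<rightarrow>\<^sub>E carrier A"
      using c by auto
    have "(\<lambda>x \<in> carrier L. ?d x \<otimes>\<^bsub>A\<^esub> c x) = (\<lambda>x \<in> carrier L. \<one>\<^bsub>A\<^esub>)"
      using PiE_mem[OF c(1)] by (intro restrict_ext) simp
    moreover have "coboundary (\<lambda>x \<in> carrier L. \<one>\<^bsub>A\<^esub>) = \<one>\<^bsub>grp_Z2 L A \<psi>\<^esub>"
      by (auto simp: coboundary_def grp_Z2_def act_one)
    ultimately have "coboundary ?d \<otimes>\<^bsub>grp_Z2 L A \<psi>\<^esub> f = \<one>\<^bsub>grp_Z2 L A \<psi>\<^esub>"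
      using c d coboundary_mult[of ?d c] by (simp add: PiE_def)
    then have "inv\<^bsub>grp_Z2 L A \<psi>\<^esub> f = coboundary ?d"
      using c d by (intro Z.inv_equality) (auto intro!: coboundary_in_grp_Z2)
    then show "inv\<^bsub>grp_Z2 L A \<psi>\<^esub> f \<in> grp_B2 L A \<psi>"
      using d grp_B2_eq by blast
  next
    fix f g assume "f \<in> grp_B2 L A \<psi>" "g \<in> grp_B2 L A \<psi>"
    then obtain c d where c: "c \<in> carrier L \<rightarrow>\<^sub>E carrier A" "f = coboundary c"
      and d: "d \<in> carrier L \<rightarrow>\<^sub>E carrier A" "g = coboundary d"
      by (auto simp: grp_B2_eq)
    have "f \<otimes>\<^bsub>grp_Z2 L A \<psi>\<^esub> g = coboundary (\<lambda>x \<in> carrier L. c x \<otimes>\<^bsub>A\<^esub> d x)"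
      using c d by (simp add: coboundary_mult PiE_def)
    moreover have "(\<lambda>x \<in> carrier L. c x \<otimes>\<^bsub>A\<^esub> d x) \<in> carrier L \<rightarrow>\<^sub>E carrier A"
      using c d by auto
    ultimately show "f \<otimes>\<^bsub>grp_Z2 L A \<psi>\<^esub> g \<in> grp_B2 L A \<psi>"
      unfolding grp_B2_eq by blast
  qed
qed

end

subsection \<open>Finiteness of the Schur multiplier\<close>

text \<open>Polynomials are coefficient lists with the leading coefficient first. Appending a
  coefficient multiplies by X and adds it, so \<open>p\<close> is X^n - a, built from the monomial
  of degree n - 1.\<close>

lemma (in field) nth_root_poly:
  fixes n :: nat
  assumes "n > 0" and "a \<in> carrier R"
  defines "p \<equiv> monom \<one> (n - 1) @ [\<ominus> a]"
  shows nth_root_poly_closed: "p \<in> carrier (poly_ring R)"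
    and nth_root_poly_degree: "degree p = n"
    and nth_root_poly_roots: "\<And>x. x \<in># roots p \<longleftrightarrow> x \<in> carrier R \<and> x [^] n = a"
proof -
  show 1: "p \<in> carrier (poly_ring R)"
    using assms(2) unfolding p_def monom_def univ_poly_carrier[symmetric] polynomial_def by auto
  show "degree p = n"
    using assms(1) by (simp add: p_def monom_def)
  fix x
  have "eval p x = \<zero> \<longleftrightarrow> x [^] n = a" if "x \<in> carrier R"
  proof -
    have "set (monom \<one> (n - 1)) \<subseteq> carrier R"
      by (auto simp: monom_def)
    then have "eval p x = eval (monom \<one> (n - 1)) x \<otimes> x \<oplus> \<ominus> a"
      unfolding p_def using assms(2) that by (intro eval_append_aux) auto
    also have "eval (monom \<one> (n - 1)) x = x [^] (n - 1)"
      using that by (simp add: eval_monom)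
    also have "x [^] (n - 1) \<otimes> x = x [^] n"
      using assms(1) by (metis Suc_pred' nat_pow_Suc)
    finally show ?thesis
      using assms(2) that by (simp add: a_minus_def[symmetric])
  qed
  then show "x \<in># roots p \<longleftrightarrow> x \<in> carrier R \<and> x [^] n = a"
    using roots_mem_iff_is_root[OF 1, of x] by (auto simp: is_root_def p_def)
qed

lemma (in field) finite_roots_of_unity:
  assumes "(n :: nat) > 0"
  shows "finite {x \<in> carrier (units_of R). x [^]\<^bsub>units_of R\<^esub> n = \<one>\<^bsub>units_of R\<^esub>}"
proof (rule finite_subset)
  show "{x \<in> carrier (units_of R). x [^]\<^bsub>units_of R\<^esub> n = \<one>\<^bsub>units_of R\<^esub>}
      \<subseteq> set_mset (roots (monom \<one> (n - 1) @ [\<ominus> \<one>]))"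
  proof
    fix x assume "x \<in> {x \<in> carrier (units_of R). x [^]\<^bsub>units_of R\<^esub> n = \<one>\<^bsub>units_of R\<^esub>}"
    then have "x \<in> Units R" "x [^] n = \<one>"
      using units_of_pow[of x n] by (simp_all add: units_of_carrier units_of_one)
    then show "x \<in># roots (monom \<one> (n - 1) @ [\<ominus> \<one>])"
      unfolding nth_root_poly_roots[OF assms one_closed] by (simp add: Units_closed)
  qed
  show "finite (set_mset (roots (monom \<one> (n - 1) @ [\<ominus> \<one>])))"
    by (rule finite_set_mset)
qed

text \<open>The polynomial X^n - a splits and has positive degree, so it has a root. The root is a
  unit, since 0^n = 0 is not the unit \<open>a\<close>.\<close>

lemma (in algebraically_closed) ex_nth_root:
  assumes "(n :: nat) > 0" and "a \<in> carrier (units_of L)"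
  shows "\<exists>x \<in> carrier (units_of L). x [^]\<^bsub>units_of L\<^esub> n = a"
proof -
  have a: "a \<in> carrier L" "a \<in> Units L"
    using assms(2) by (auto simp: units_of_carrier)
  let ?p = "monom \<one>\<^bsub>L\<^esub> (n - 1) @ [\<ominus>\<^bsub>L\<^esub> a]"
  have "size (roots ?p) = n"
    using roots_over_carrier[OF nth_root_poly_closed[OF assms(1) a(1)]]
      nth_root_poly_degree[OF assms(1) a(1)]
    by (simp add: splitted_def)
  then have "roots ?p \<noteq> {#}"
    using assms(1) by auto
  then obtain x where x: "x \<in> carrier L" "x [^]\<^bsub>L\<^esub> n = a"
    using nth_root_poly_roots[OF assms(1) a(1)] by (meson multiset_nonemptyE)
  have "x \<noteq> \<zero>\<^bsub>L\<^esub>"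
  proof
    assume "x = \<zero>\<^bsub>L\<^esub>"
    then have "a = \<zero>\<^bsub>L\<^esub>"
      using x(2) assms(1) nat_pow_zero[of n] by simp
    then show False
      using a(2) by (simp add: field_Units)
  qed
  then have "x \<in> Units L"
    using x(1) by (simp add: field_Units)
  then show ?thesis
    using x(2) by (auto simp: units_of_carrier units_of_pow)
qed

section \<open>Finiteness of second cohomology with trivial action\<close>

lemma (in comm_group) comm_group_action_trivial:
  assumes "group L"
  shows "comm_group_action L G (\<lambda>_ a. a)"
  using assms comm_group_axioms
  by (auto simp: comm_group_action_def comm_group_action_axioms_def hom_def)

text \<open>Multiply the cocycle identity over the third variable.\<close>

lemma (in comm_group_action) cocycle_pow_card_eq_coboundary:
  assumes triv: "\<And>x a. \<lbrakk>x \<in> carrier L; a \<in> carrier A\<rbrakk> \<Longrightarrow> \<psi> x a = a"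
    and "finite (carrier L)" and f: "f \<in> carrier (grp_Z2 L A \<psi>)"
  obtains b where "b \<in> carrier L \<rightarrow>\<^sub>E carrier A"
    and "\<And>x y. \<lbrakk>x \<in> carrier L; y \<in> carrier L\<rbrakk> \<Longrightarrow> f (x, y) [^]\<^bsub>A\<^esub> order L = coboundary b (x, y)"
proof
  have fc: "f (x, y) \<in> carrier A" if "x \<in> carrier L" "y \<in> carrier L" for x y
    using f that by (rule grp_Z2_closed)
  define b where "b = (\<lambda>x \<in> carrier L. \<Otimes>\<^bsub>A\<^esub>y \<in> carrier L. f (x, y))"
  have bc: "b x \<in> carrier A" if "x \<in> carrier L" for x
    using that fc by (auto simp: b_def intro!: A.finprod_closed)
  then show "b \<in> carrier L \<rightarrow>\<^sub>E carrier A"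
    by (auto simp: b_def)
  fix x y assume x: "x \<in> carrier L" and y: "y \<in> carrier L"
  have "f (x, y) [^]\<^bsub>A\<^esub> order L \<otimes>\<^bsub>A\<^esub> b (x \<otimes>\<^bsub>L\<^esub> y)
      = (\<Otimes>\<^bsub>A\<^esub>z \<in> carrier L. f (x, y) \<otimes>\<^bsub>A\<^esub> f (x \<otimes>\<^bsub>L\<^esub> y, z))"
    using x y fc by (simp add: A.finprod_multf A.finprod_const Pi_iff order_def b_def)
  also have "\<dots> = (\<Otimes>\<^bsub>A\<^esub>z \<in> carrier L. f (x, y \<otimes>\<^bsub>L\<^esub> z) \<otimes>\<^bsub>A\<^esub> f (y, z))"
    using f x y fc by (intro A.finprod_cong') (auto simp: grp_Z2_iff triv)
  also have "\<dots> = (\<Otimes>\<^bsub>A\<^esub>z \<in> carrier L. f (x, y \<otimes>\<^bsub>L\<^esub> z)) \<otimes>\<^bsub>A\<^esub> b y"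
    using x y fc by (simp add: A.finprod_multf Pi_iff b_def)
  also have "(\<Otimes>\<^bsub>A\<^esub>z \<in> carrier L. f (x, y \<otimes>\<^bsub>L\<^esub> z)) = b x"
  proof -
    \<comment> \<open>Left translation by \<open>y\<close> permutes the group, so the product over
      the translated argument is again \<open>b x\<close>.\<close>
    have inj: "inj_on (\<lambda>z. y \<otimes>\<^bsub>L\<^esub> z) (carrier L)"
      using y by (simp add: L.inj_on_cmult)
    have "(\<lambda>z. y \<otimes>\<^bsub>L\<^esub> z) ` carrier L = carrier L"
      using y by (simp add: L.surj_const_mult)
    then show ?thesis
      using A.finprod_reindex[of "\<lambda>z. f (x, z)" "\<lambda>z. y \<otimes>\<^bsub>L\<^esub> z" "carrier L"] inj x fc
      by (simp add: b_def Pi_iff)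
  qed
  finally have "f (x, y) [^]\<^bsub>A\<^esub> order L = b x \<otimes>\<^bsub>A\<^esub> b y \<otimes>\<^bsub>A\<^esub> inv\<^bsub>A\<^esub> b (x \<otimes>\<^bsub>L\<^esub> y)"
    using x y fc bc by (intro A.inv_solve_right[THEN iffD2]) auto
  then show "f (x, y) [^]\<^bsub>A\<^esub> order L = coboundary b (x, y)"
    using x y bc by (simp add: coboundary_apply triv A.m_ac)
qed

text \<open>Let n be the order of \<open>L\<close>. The n-th power of a cocycle \<open>f\<close> is
  the coboundary of some \<open>b\<close>. If \<open>c\<close> is a pointwise n-th root of
  \<open>b\<close>, then \<open>f\<close> divided by the coboundary of \<open>c\<close> is a
  cohomologous cocycle with values in the n-torsion of \<open>A\<close>. Only finitely many
  functions on pairs take values in that finite set.\<close>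

lemma (in comm_group_action) finite_grp_H2_of_trivial_action:
  assumes triv: "\<And>x a. \<lbrakk>x \<in> carrier L; a \<in> carrier A\<rbrakk> \<Longrightarrow> \<psi> x a = a"
    and fin: "finite (carrier L)"
    and roots: "\<And>a. a \<in> carrier A \<Longrightarrow> \<exists>x \<in> carrier A. x [^]\<^bsub>A\<^esub> order L = a"
    and torsion: "finite {x \<in> carrier A. x [^]\<^bsub>A\<^esub> order L = \<one>\<^bsub>A\<^esub>}" (is "finite ?T")
  shows "finite (carrier (grp_H2 L A \<psi>))"
proof -
  interpret Z: comm_group "grp_Z2 L A \<psi>"
    by (rule comm_group_grp_Z2)
  have "\<exists>g \<in> carrier L \<times> carrier L \<rightarrow>\<^sub>E ?T. g \<in> carrier (grp_Z2 L A \<psi>) \<and>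
      f \<otimes>\<^bsub>grp_Z2 L A \<psi>\<^esub> inv\<^bsub>grp_Z2 L A \<psi>\<^esub> g \<in> grp_B2 L A \<psi>"
    if f: "f \<in> carrier (grp_Z2 L A \<psi>)" for f
  proof -
    obtain b where b: "b \<in> carrier L \<rightarrow>\<^sub>E carrier A"
      and fb: "\<And>x y. \<lbrakk>x \<in> carrier L; y \<in> carrier L\<rbrakk> \<Longrightarrow> f (x, y) [^]\<^bsub>A\<^esub> order L = coboundary b (x, y)"
      using cocycle_pow_card_eq_coboundary[OF triv fin f] by blast
    obtain r where r: "\<And>a. a \<in> carrier A \<Longrightarrow> r a \<in> carrier A \<and> r a [^]\<^bsub>A\<^esub> order L = a"
      using roots by metis
    \<comment> \<open>The roots are chosen point by point; no multiplicativity of the choice is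
      required, as \<open>c\<close> is only a 1-cochain.\<close>
    define c where "c = (\<lambda>x \<in> carrier L. r (b x))"
    have root: "c x \<in> carrier A" "c x [^]\<^bsub>A\<^esub> order L = b x" if "x \<in> carrier L" for x
      using r[OF PiE_mem[OF b that]] that by (simp_all add: c_def)
    then have c: "c \<in> carrier L \<rightarrow>\<^sub>E carrier A"
      by (simp add: c_def PiE_iff)
    have d: "coboundary c \<in> grp_B2 L A \<psi>" "coboundary c \<in> carrier (grp_Z2 L A \<psi>)"
      using c coboundary_in_grp_Z2[of c] by (auto simp: grp_B2_eq)
    define g where "g = f \<otimes>\<^bsub>grp_Z2 L A \<psi>\<^esub> inv\<^bsub>grp_Z2 L A \<psi>\<^esub> (coboundary c)"
    have g: "g \<in> carrier (grp_Z2 L A \<psi>)"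
      using f d by (simp add: g_def)
    have "g (x, y) [^]\<^bsub>A\<^esub> order L = \<one>\<^bsub>A\<^esub>" if xy: "x \<in> carrier L" "y \<in> carrier L" for x y
    proof -
      have cc: "c x \<in> carrier A" "c y \<in> carrier A" "c (x \<otimes>\<^bsub>L\<^esub> y) \<in> carrier A"
        "c x [^]\<^bsub>A\<^esub> order L = b x" "c y [^]\<^bsub>A\<^esub> order L = b y"
        "c (x \<otimes>\<^bsub>L\<^esub> y) [^]\<^bsub>A\<^esub> order L = b (x \<otimes>\<^bsub>L\<^esub> y)"
        using xy root by simp_all
      have "coboundary c (x, y) [^]\<^bsub>A\<^esub> order L = coboundary b (x, y)"
        using xy cc PiE_mem[OF b]
        by (simp add: coboundary_apply triv A.nat_pow_distrib A.nat_pow_inv)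
      moreover have fd: "f (x, y) \<in> carrier A" "coboundary c (x, y) \<in> carrier A"
        using f d(2) xy by (simp_all add: grp_Z2_closed)
      moreover have "g (x, y) = f (x, y) \<otimes>\<^bsub>A\<^esub> inv\<^bsub>A\<^esub> coboundary c (x, y)"
        using xy d(2) by (simp add: g_def mult_grp_Z2 inv_grp_Z2)
      ultimately have "g (x, y) [^]\<^bsub>A\<^esub> order L = coboundary b (x, y) \<otimes>\<^bsub>A\<^esub> inv\<^bsub>A\<^esub> coboundary b (x, y)"
        using fb[OF xy] by (simp add: A.nat_pow_distrib A.nat_pow_inv)
      moreover have "coboundary b (x, y) \<in> carrier A"
        using A.nat_pow_closed[OF fd(1)] fb[OF xy] by metis
      ultimately show ?thesis
        by simp
    qed
    then have "g \<in> carrier L \<times> carrier L \<rightarrow>\<^sub>E ?T"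
      using grp_Z2_funcset[OF g] by (simp add: PiE_iff split_paired_all)
    moreover have "f \<otimes>\<^bsub>grp_Z2 L A \<psi>\<^esub> inv\<^bsub>grp_Z2 L A \<psi>\<^esub> g = coboundary c"
      using f d(2) by (simp add: g_def Z.inv_mult Z.m_assoc[symmetric])
    ultimately show ?thesis
      using g d(1) by (intro bexI[of _ g]) simp_all
  qed
  then have ex: "\<exists>g. g \<in> carrier L \<times> carrier L \<rightarrow>\<^sub>E ?T \<and> g \<in> carrier (grp_Z2 L A \<psi>) \<and>
      f \<otimes>\<^bsub>grp_Z2 L A \<psi>\<^esub> inv\<^bsub>grp_Z2 L A \<psi>\<^esub> g \<in> grp_B2 L A \<psi>" (is "\<exists>g. ?good f g")
    if "f \<in> carrier (grp_Z2 L A \<psi>)" for f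
    using that unfolding Bex_def by blast
  \<comment> \<open>\<open>q f\<close> is a torsion-valued cocycle cohomologous to \<open>f\<close>.
    Cocycles with the same \<open>q\<close> lie in the same coset, so \<open>q\<close> serves as the
    separating function of \<open>card_rcosets_le\<close>.\<close>
  define q where "q f = (SOME g. ?good f g)" for f
  have q: "?good f (q f)" if "f \<in> carrier (grp_Z2 L A \<psi>)" for f
    unfolding q_def by (rule someI_ex[OF ex[OF that]])
  have "f \<otimes>\<^bsub>grp_Z2 L A \<psi>\<^esub> inv\<^bsub>grp_Z2 L A \<psi>\<^esub> g \<in> grp_B2 L A \<psi>"
    if fg: "f \<in> carrier (grp_Z2 L A \<psi>)" "g \<in> carrier (grp_Z2 L A \<psi>)" "q f = q g" for f g
  proof -
    have "grp_B2 L A \<psi> #>\<^bsub>grp_Z2 L A \<psi>\<^esub> f = grp_B2 L A \<psi> #>\<^bsub>grp_Z2 L A \<psi>\<^esub> q f"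
      using q[OF fg(1)] fg(1) by (intro Z.rcos_eq_iff[OF subgroup_grp_B2, THEN iffD2]) auto
    moreover have "grp_B2 L A \<psi> #>\<^bsub>grp_Z2 L A \<psi>\<^esub> g = grp_B2 L A \<psi> #>\<^bsub>grp_Z2 L A \<psi>\<^esub> q g"
      using q[OF fg(2)] fg(2) by (intro Z.rcos_eq_iff[OF subgroup_grp_B2, THEN iffD2]) auto
    ultimately show ?thesis
      using fg by (intro Z.rcos_eq_iff[OF subgroup_grp_B2, THEN iffD1]) auto
  qed
  then have "finite (rcosets\<^bsub>grp_Z2 L A \<psi>\<^esub> grp_B2 L A \<psi>)"
    using Z.card_rcosets_le[OF subgroup_grp_B2, of "carrier L \<times> carrier L \<rightarrow>\<^sub>E ?T" q]
      q fin torsion by (simp add: finite_PiE Pi_iff)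
  then show ?thesis
    by (simp add: grp_H2_def FactGroup_def)
qed

subsection \<open>Cohomology of a group of order two\<close>

text \<open>For \<open>L\<close> of order two generated by \<open>t\<close> and a fixed by
  \<open>t\<close>, this is the normalised cocycle that realises the periodicity isomorphism from
  invariants modulo norms to the second cohomology of \<open>L\<close>.\<close>

definition cyclic_cocycle ::
  "('l, 'm) monoid_scheme \<Rightarrow> ('a, 'n) monoid_scheme \<Rightarrow> 'l \<Rightarrow> 'a \<Rightarrow> 'l \<times> 'l \<Rightarrow> 'a"
  where "cyclic_cocycle L A t a =
    (\<lambda>(x, y) \<in> carrier L \<times> carrier L. if x = t \<and> y = t then a else \<one>\<^bsub>A\<^esub>)"

locale order_two_action = comm_group_action +
  fixes t
  assumes carrier_two: "carrier L = {\<one>\<^bsub>L\<^esub>, t}" and t_neq_one: "t \<noteq> \<one>\<^bsub>L\<^esub>"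
    and t_sq: "t \<otimes>\<^bsub>L\<^esub> t = \<one>\<^bsub>L\<^esub>"
    and act_unit: "a \<in> carrier A \<Longrightarrow> \<psi> \<one>\<^bsub>L\<^esub> a = a"
begin

lemma t_closed: "t \<in> carrier L"
  by (simp add: carrier_two)

text \<open>All values of the function are fixed by the action, so the identity loses its twist and
  is checked on the eight triples. The triple \<open>(t, t, t)\<close> is where invariance of
  \<open>a\<close> matters.\<close>

lemma cyclic_cocycle_in_grp_Z2:
  assumes "a \<in> carrier A" and "\<psi> t a = a"
  shows "cyclic_cocycle L A t a \<in> carrier (grp_Z2 L A \<psi>)"
proof -
  have "\<psi> x (cyclic_cocycle L A t a p) = cyclic_cocycle L A t a p"
    if "x \<in> carrier L" "p \<in> carrier L \<times> carrier L" for x p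
    using that assms act_unit act_one[OF t_closed]
    by (auto simp: cyclic_cocycle_def carrier_two split: if_splits)
  moreover have "cyclic_cocycle L A t a (x, y) \<otimes>\<^bsub>A\<^esub> cyclic_cocycle L A t a (x \<otimes>\<^bsub>L\<^esub> y, z)
      = cyclic_cocycle L A t a (x, y \<otimes>\<^bsub>L\<^esub> z) \<otimes>\<^bsub>A\<^esub> cyclic_cocycle L A t a (y, z)"
    if "x \<in> {\<one>\<^bsub>L\<^esub>, t}" "y \<in> {\<one>\<^bsub>L\<^esub>, t}" "z \<in> {\<one>\<^bsub>L\<^esub>, t}" for x y z
    using that assms t_neq_one t_closed L.one_closed t_sq
    by (elim insertE emptyE) (simp_all add: cyclic_cocycle_def)
  moreover have "cyclic_cocycle L A t a \<in> carrier L \<times> carrier L \<rightarrow>\<^sub>E carrier A"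
    using assms by (auto simp: cyclic_cocycle_def)
  ultimately show ?thesis
    by (simp add: grp_Z2_iff carrier_two)
qed

text \<open>Injectivity of the map from invariants modulo norms. If the quotient of the two cocycles
  is the coboundary of \<open>c\<close>, its value at the pair of units forces \<open>c\<close> to
  be trivial at the unit, and its value at \<open>(t, t)\<close> is then the norm of
  \<open>c t\<close>.\<close>

lemma cyclic_cocycle_quotient_in_grp_B2:
  assumes a: "a \<in> carrier A" "\<psi> t a = a" and b: "b \<in> carrier A" "\<psi> t b = b"
    and B2: "cyclic_cocycle L A t a \<otimes>\<^bsub>grp_Z2 L A \<psi>\<^esub>
      inv\<^bsub>grp_Z2 L A \<psi>\<^esub> (cyclic_cocycle L A t b) \<in> grp_B2 L A \<psi>"
  shows "\<exists>c \<in> carrier A. a \<otimes>\<^bsub>A\<^esub> inv\<^bsub>A\<^esub> b = \<psi> t c \<otimes>\<^bsub>A\<^esub> c"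
proof -
  let ?f = "\<lambda>p. cyclic_cocycle L A t a p \<otimes>\<^bsub>A\<^esub> inv\<^bsub>A\<^esub> cyclic_cocycle L A t b p"
  obtain c where c: "c \<in> carrier L \<rightarrow>\<^sub>E carrier A" and
    "cyclic_cocycle L A t a \<otimes>\<^bsub>grp_Z2 L A \<psi>\<^esub> inv\<^bsub>grp_Z2 L A \<psi>\<^esub> (cyclic_cocycle L A t b)
      = coboundary c"
    using B2 unfolding grp_B2_eq by blast
  then have "coboundary c = (\<lambda>p \<in> carrier L \<times> carrier L. ?f p)"
    using cyclic_cocycle_in_grp_Z2[OF b] by (simp add: mult_grp_Z2 inv_grp_Z2 cong: restrict_cong)
  then have eq: "coboundary c (x, y) = ?f (x, y)" if "x \<in> carrier L" "y \<in> carrier L" for x y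
    using that by simp
  have cc: "c \<one>\<^bsub>L\<^esub> \<in> carrier A" "c t \<in> carrier A"
    using c t_closed by auto
  have "coboundary c (\<one>\<^bsub>L\<^esub>, \<one>\<^bsub>L\<^esub>) = c \<one>\<^bsub>L\<^esub>"
    using cc by (simp add: coboundary_apply act_closed act_unit)
  moreover have "?f (\<one>\<^bsub>L\<^esub>, \<one>\<^bsub>L\<^esub>) = \<one>\<^bsub>A\<^esub>"
    using t_neq_one by (simp add: cyclic_cocycle_def)
  ultimately have "c \<one>\<^bsub>L\<^esub> = \<one>\<^bsub>A\<^esub>"
    using eq[of "\<one>\<^bsub>L\<^esub>" "\<one>\<^bsub>L\<^esub>"] by simp
  then have "coboundary c (t, t) = \<psi> t (c t) \<otimes>\<^bsub>A\<^esub> c t"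
    using cc t_closed by (simp add: coboundary_apply act_closed t_sq)
  then have "a \<otimes>\<^bsub>A\<^esub> inv\<^bsub>A\<^esub> b = \<psi> t (c t) \<otimes>\<^bsub>A\<^esub> c t"
    using eq[of t t] t_closed by (simp add: cyclic_cocycle_def)
  then show ?thesis
    using cc by blast
qed

end

subsection \<open>Extension cocycles\<close>

text \<open>Here \<open>G\<close> acts trivially on the units of \<open>K\<close>, so the inherited
  cocycles and coboundaries are those of the Schur multiplier of \<open>G\<close>. The map
  \<open>s\<close> is the automorphism through which the generator of the group of order two
  acts.\<close>

locale involution_cochains =
  comm_group_action G "units_of K" "\<lambda>_ a. a" + K: cring K
  for G :: "('g, 'm) monoid_scheme" and K :: "('k, 'c) ring_scheme" +
  fixes s :: "'g \<Rightarrow> 'g"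
  assumes s_hom: "s \<in> hom G G" and s_invol: "g \<in> carrier G \<Longrightarrow> s (s g) = g"
begin

abbreviation "U \<equiv> units_of K"

lemma s_closed [simp]: "g \<in> carrier G \<Longrightarrow> s g \<in> carrier G"
  using s_hom hom_in_carrier by metis

lemma s_mult: "\<lbrakk>g \<in> carrier G; u \<in> carrier G\<rbrakk> \<Longrightarrow> s (g \<otimes>\<^bsub>G\<^esub> u) = s g \<otimes>\<^bsub>G\<^esub> s u"
  using s_hom hom_mult by metis

lemma s_one: "s \<one>\<^bsub>G\<^esub> = \<one>\<^bsub>G\<^esub>"
  using s_hom hom_one L.is_group by metis

abbreviation ext_C2 where
  "ext_C2 \<equiv> product_group (carrier G) (\<lambda>_. U) \<times>\<times> product_group (carrier G \<times> carrier G) (\<lambda>_. U)"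

text \<open>All conditions are moved from the ring \<open>K\<close> to its unit group
  \<open>U\<close>, where inverses and the laws of abelian groups apply, and the cocycle identity
  for \<open>\<tau>\<close> is absorbed into membership in \<open>schur_Z2 K G\<close>.\<close>

lemma ext_Z2_iff:
  "(\<sigma>, \<tau>) \<in> carrier (ext_Z2 K G s) \<longleftrightarrow>
    \<sigma> \<in> carrier G \<rightarrow>\<^sub>E carrier U \<and> \<tau> \<in> carrier (schur_Z2 K G) \<and> \<sigma> \<one>\<^bsub>G\<^esub> = \<one>\<^bsub>U\<^esub> \<and>
    (\<forall>g \<in> carrier G. \<tau> (\<one>\<^bsub>G\<^esub>, g) = \<one>\<^bsub>U\<^esub> \<and> \<tau> (g, \<one>\<^bsub>G\<^esub>) = \<one>\<^bsub>U\<^esub>) \<and>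
    (\<forall>g \<in> carrier G. \<sigma> (s g) = \<sigma> g) \<and>
    (\<forall>g \<in> carrier G. \<forall>u \<in> carrier G.
      \<sigma> (g \<otimes>\<^bsub>G\<^esub> u) = \<tau> (g, u) \<otimes>\<^bsub>U\<^esub> \<tau> (s g, s u) \<otimes>\<^bsub>U\<^esub> \<sigma> g \<otimes>\<^bsub>U\<^esub> \<sigma> u)"
  by (auto simp: ext_Z2_def grp_Z2_iff units_of_mult units_of_one)

lemma ext_Z2D:
  assumes "(\<sigma>, \<tau>) \<in> carrier (ext_Z2 K G s)"
  shows "\<sigma> \<in> carrier G \<rightarrow>\<^sub>E carrier U" and "\<tau> \<in> carrier (schur_Z2 K G)"
  using assms unfolding ext_Z2_iff by blast+

lemma ext_Z2_eq: "ext_Z2 K G s = ext_C2\<lparr>carrier := carrier (ext_Z2 K G s)\<rparr>"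
  by (simp add: ext_Z2_def)

lemma mult_ext_Z2:
  "(\<sigma>, \<tau>) \<otimes>\<^bsub>ext_Z2 K G s\<^esub> (\<sigma>', \<tau>')
    = (\<lambda>g \<in> carrier G. \<sigma> g \<otimes>\<^bsub>U\<^esub> \<sigma>' g, \<tau> \<otimes>\<^bsub>schur_Z2 K G\<^esub> \<tau>')"
  by (simp add: ext_Z2_def mult_grp_Z2)

text \<open>The inverse is computed in the ambient product first, because closure under inverses
  enters the proof that extension cocycles form a subgroup.\<close>

lemma inv_ext_C2:
  assumes "(\<sigma>, \<tau>) \<in> carrier (ext_Z2 K G s)"
  shows "inv\<^bsub>ext_C2\<^esub> (\<sigma>, \<tau>) = (\<lambda>g \<in> carrier G. inv\<^bsub>U\<^esub> \<sigma> g, inv\<^bsub>schur_Z2 K G\<^esub> \<tau>)"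
proof -
  have "\<sigma> \<in> carrier G \<rightarrow>\<^sub>E carrier U" and \<tau>: "\<tau> \<in> carrier (schur_Z2 K G)"
    using ext_Z2D[OF assms] .
  then show ?thesis
    using grp_Z2_funcset[OF \<tau>] by (simp add: inv_grp_Z2)
qed

lemma one_ext_Z2_closed: "\<one>\<^bsub>ext_C2\<^esub> \<in> carrier (ext_Z2 K G s)"
proof -
  have "\<one>\<^bsub>C2\<^esub> \<in> carrier (schur_Z2 K G)"
    using subgroup.one_closed[OF subgroup_grp_Z2] .
  then show ?thesis
    by (simp add: ext_Z2_iff)
qed

lemma subgroup_ext_Z2: "subgroup (carrier (ext_Z2 K G s)) ext_C2"
proof (rule group.subgroupI)
  interpret Z: comm_group "schur_Z2 K G"
    by (rule comm_group_grp_Z2)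
  show "group ext_C2"
    by (simp add: DirProd_group)
  show "carrier (ext_Z2 K G s) \<subseteq> carrier ext_C2"
    using ext_Z2D grp_Z2_funcset by fastforce
  show "carrier (ext_Z2 K G s) \<noteq> {}"
    using one_ext_Z2_closed by blast
  fix p assume p: "p \<in> carrier (ext_Z2 K G s)"
  obtain \<sigma> \<tau> where p_eq: "p = (\<sigma>, \<tau>)"
    by fastforce
  note st = p[unfolded p_eq]
  have \<sigma>: "\<sigma> g \<in> carrier U" if "g \<in> carrier G" for g
    using that by (rule PiE_mem[OF ext_Z2D(1)[OF st]])
  note \<tau> = ext_Z2D(2)[OF st]
  show "inv\<^bsub>ext_C2\<^esub> p \<in> carrier (ext_Z2 K G s)"
    unfolding p_eq inv_ext_C2[OF st] ext_Z2_iff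
    using st[unfolded ext_Z2_iff] \<sigma> Z.inv_closed[OF \<tau>] \<tau>
    by (simp add: inv_grp_Z2 grp_Z2_closed A.inv_mult[symmetric] Pi_iff)
  fix q assume q: "q \<in> carrier (ext_Z2 K G s)"
  obtain \<sigma>' \<tau>' where q_eq: "q = (\<sigma>', \<tau>')"
    by fastforce
  note st' = q[unfolded q_eq]
  have \<sigma>': "\<sigma>' g \<in> carrier U" if "g \<in> carrier G" for g
    using that by (rule PiE_mem[OF ext_Z2D(1)[OF st']])
  note \<tau>' = ext_Z2D(2)[OF st']
  have "p \<otimes>\<^bsub>ext_C2\<^esub> q = (\<lambda>g \<in> carrier G. \<sigma> g \<otimes>\<^bsub>U\<^esub> \<sigma>' g, \<tau> \<otimes>\<^bsub>schur_Z2 K G\<^esub> \<tau>')"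
    by (simp add: p_eq q_eq mult_grp_Z2)
  also have "\<dots> \<in> carrier (ext_Z2 K G s)"
    unfolding ext_Z2_iff
  proof (intro conjI ballI)
    show "(\<lambda>g \<in> carrier G. \<sigma> g \<otimes>\<^bsub>U\<^esub> \<sigma>' g) \<in> carrier G \<rightarrow>\<^sub>E carrier U"
      using \<sigma> \<sigma>' by simp
    show "\<tau> \<otimes>\<^bsub>schur_Z2 K G\<^esub> \<tau>' \<in> carrier (schur_Z2 K G)"
      using \<tau> \<tau>' by (rule Z.m_closed)
    show "(\<lambda>g \<in> carrier G. \<sigma> g \<otimes>\<^bsub>U\<^esub> \<sigma>' g) \<one>\<^bsub>G\<^esub> = \<one>\<^bsub>U\<^esub>"
      using st st' by (simp add: ext_Z2_iff)
    fix g assume g: "g \<in> carrier G"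
    show "(\<tau> \<otimes>\<^bsub>schur_Z2 K G\<^esub> \<tau>') (\<one>\<^bsub>G\<^esub>, g) = \<one>\<^bsub>U\<^esub>" "(\<tau> \<otimes>\<^bsub>schur_Z2 K G\<^esub> \<tau>') (g, \<one>\<^bsub>G\<^esub>) = \<one>\<^bsub>U\<^esub>"
      using st st' g by (simp_all add: ext_Z2_iff mult_grp_Z2)
    show "(\<lambda>g \<in> carrier G. \<sigma> g \<otimes>\<^bsub>U\<^esub> \<sigma>' g) (s g) = (\<lambda>g \<in> carrier G. \<sigma> g \<otimes>\<^bsub>U\<^esub> \<sigma>' g) g"
      using st st' g by (simp add: ext_Z2_iff)
    fix u assume u: "u \<in> carrier G"
    have "\<sigma> (g \<otimes>\<^bsub>G\<^esub> u) = \<tau> (g, u) \<otimes>\<^bsub>U\<^esub> \<tau> (s g, s u) \<otimes>\<^bsub>U\<^esub> \<sigma> g \<otimes>\<^bsub>U\<^esub> \<sigma> u"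
      "\<sigma>' (g \<otimes>\<^bsub>G\<^esub> u) = \<tau>' (g, u) \<otimes>\<^bsub>U\<^esub> \<tau>' (s g, s u) \<otimes>\<^bsub>U\<^esub> \<sigma>' g \<otimes>\<^bsub>U\<^esub> \<sigma>' u"
      using st st' g u by (simp_all add: ext_Z2_iff)
    moreover have "\<tau> (g, u) \<in> carrier U" "\<tau> (s g, s u) \<in> carrier U"
      "\<tau>' (g, u) \<in> carrier U" "\<tau>' (s g, s u) \<in> carrier U"
      using grp_Z2_closed[OF \<tau>] grp_Z2_closed[OF \<tau>'] g u by simp_all
    ultimately show "(\<lambda>g \<in> carrier G. \<sigma> g \<otimes>\<^bsub>U\<^esub> \<sigma>' g) (g \<otimes>\<^bsub>G\<^esub> u)
        = (\<tau> \<otimes>\<^bsub>schur_Z2 K G\<^esub> \<tau>') (g, u) \<otimes>\<^bsub>U\<^esub> (\<tau> \<otimes>\<^bsub>schur_Z2 K G\<^esub> \<tau>') (s g, s u)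
          \<otimes>\<^bsub>U\<^esub> (\<lambda>g \<in> carrier G. \<sigma> g \<otimes>\<^bsub>U\<^esub> \<sigma>' g) g \<otimes>\<^bsub>U\<^esub> (\<lambda>g \<in> carrier G. \<sigma> g \<otimes>\<^bsub>U\<^esub> \<sigma>' g) u"
      using g u \<sigma> \<sigma>' by (simp add: mult_grp_Z2 A.m_ac)
  qed
  finally show "p \<otimes>\<^bsub>ext_C2\<^esub> q \<in> carrier (ext_Z2 K G s)" .
qed

lemma comm_group_ext_Z2: "comm_group (ext_Z2 K G s)"
proof -
  have "comm_group ext_C2"
    using A.comm_group_axioms by (intro comm_group_DirProd comm_group_product_group)
  then show ?thesis
    using comm_group.subgroup_imp_comm_group[OF _ subgroup_ext_Z2] ext_Z2_eq by simp
qed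

lemma inv_ext_Z2:
  assumes "(\<sigma>, \<tau>) \<in> carrier (ext_Z2 K G s)"
  shows "inv\<^bsub>ext_Z2 K G s\<^esub> (\<sigma>, \<tau>) = (\<lambda>g \<in> carrier G. inv\<^bsub>U\<^esub> \<sigma> g, inv\<^bsub>schur_Z2 K G\<^esub> \<tau>)"
proof -
  have "group ext_C2"
    by (simp add: DirProd_group)
  then have "inv\<^bsub>ext_Z2 K G s\<^esub> (\<sigma>, \<tau>) = inv\<^bsub>ext_C2\<^esub> (\<sigma>, \<tau>)"
    using group.m_inv_consistent[OF _ subgroup_ext_Z2 assms] ext_Z2_eq by simp
  then show ?thesis
    using inv_ext_C2[OF assms] by simp
qed

text \<open>
  The function \<open>\<gamma>\<close> of the definition of \<open>ext_B2\<close> is the pointwise inverse of \<open>c\<close>, which makes the second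
  component an ordinary 2-coboundary.
\<close>

definition ext_coboundary where
  "ext_coboundary c = (\<lambda>g \<in> carrier G. inv\<^bsub>U\<^esub> c g \<otimes>\<^bsub>U\<^esub> inv\<^bsub>U\<^esub> c (s g), coboundary c)"

lemma ext_coboundary_inverse:
  assumes "\<gamma> \<in> carrier G \<rightarrow>\<^sub>E carrier U"
  shows "ext_coboundary (\<lambda>g \<in> carrier G. inv\<^bsub>U\<^esub> \<gamma> g) =
    ((\<lambda>g \<in> carrier G. \<gamma> g \<otimes>\<^bsub>K\<^esub> \<gamma> (s g)),
      (\<lambda>(g, u) \<in> carrier G \<times> carrier G.
         inv\<^bsub>K\<^esub> (\<gamma> g) \<otimes>\<^bsub>K\<^esub> inv\<^bsub>K\<^esub> (\<gamma> u) \<otimes>\<^bsub>K\<^esub> \<gamma> (g \<otimes>\<^bsub>G\<^esub> u)))"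
proof -
  have \<gamma>: "\<gamma> g \<in> carrier U" if "g \<in> carrier G" for g
    using assms that by auto
  have \<gamma>_inv: "inv\<^bsub>K\<^esub> (\<gamma> g) = inv\<^bsub>U\<^esub> \<gamma> g" if "g \<in> carrier G" for g
    using K.units_of_inv \<gamma>[OF that] by (simp add: units_of_carrier)
  have "inv\<^bsub>U\<^esub> \<gamma> u \<otimes>\<^bsub>U\<^esub> \<gamma> (g \<otimes>\<^bsub>G\<^esub> u) \<otimes>\<^bsub>U\<^esub> inv\<^bsub>U\<^esub> \<gamma> g
      = inv\<^bsub>K\<^esub> (\<gamma> g) \<otimes>\<^bsub>U\<^esub> inv\<^bsub>K\<^esub> (\<gamma> u) \<otimes>\<^bsub>U\<^esub> \<gamma> (g \<otimes>\<^bsub>G\<^esub> u)"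
    if "g \<in> carrier G" "u \<in> carrier G" for g u
    using that \<gamma> by (simp add: \<gamma>_inv A.m_ac)
  then show ?thesis
    using \<gamma> by (auto simp: ext_coboundary_def coboundary_def units_of_mult fun_eq_iff)
qed

text \<open>Pointwise inversion is an involution of the normalised 1-cochains, so replacing each
  cochain by its inverse does not change the set of resulting pairs.\<close>

lemma ext_B2_eq:
  "ext_B2 K G s = ext_coboundary ` {c \<in> carrier G \<rightarrow>\<^sub>E carrier U. c \<one>\<^bsub>G\<^esub> = \<one>\<^bsub>U\<^esub>}"
proof -
  let ?C = "{c \<in> carrier G \<rightarrow>\<^sub>E carrier U. c \<one>\<^bsub>G\<^esub> = \<one>\<^bsub>U\<^esub>}"
  let ?inv = "\<lambda>\<gamma>. \<lambda>g \<in> carrier G. inv\<^bsub>U\<^esub> \<gamma> g"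
  have inv_inv: "?inv (?inv c) = c" if "c \<in> ?C" for c
    using that by (auto simp: fun_eq_iff PiE_iff extensional_def)
  have inv_C: "?inv c \<in> ?C" if "c \<in> ?C" for c
    using that by auto
  have "?inv ` ?C = ?C"
  proof
    show "?inv ` ?C \<subseteq> ?C"
      using inv_C by blast
    show "?C \<subseteq> ?inv ` ?C"
    proof
      fix c assume c: "c \<in> ?C"
      show "c \<in> ?inv ` ?C"
        by (rule image_eqI[of c ?inv "?inv c", OF inv_inv[OF c, symmetric] inv_C[OF c]])
    qed
  qed
  moreover have "ext_B2 K G s = ext_coboundary ` ?inv ` ?C"
  proof -
    have "ext_coboundary ` ?inv ` ?C = (\<lambda>\<gamma>.
      ((\<lambda>g \<in> carrier G. \<gamma> g \<otimes>\<^bsub>K\<^esub> \<gamma> (s g)),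
        (\<lambda>(g, u) \<in> carrier G \<times> carrier G.
           inv\<^bsub>K\<^esub> (\<gamma> g) \<otimes>\<^bsub>K\<^esub> inv\<^bsub>K\<^esub> (\<gamma> u) \<otimes>\<^bsub>K\<^esub> \<gamma> (g \<otimes>\<^bsub>G\<^esub> u)))) ` ?C"
      unfolding image_image by (intro image_cong refl ext_coboundary_inverse) blast
    then show ?thesis
      unfolding ext_B2_def units_of_one by blast
  qed
  ultimately show ?thesis
    by simp
qed

lemma ext_coboundary_mult:
  assumes "c \<in> carrier G \<rightarrow> carrier U" "d \<in> carrier G \<rightarrow> carrier U"
  shows "ext_coboundary c \<otimes>\<^bsub>ext_Z2 K G s\<^esub> ext_coboundary d
    = ext_coboundary (\<lambda>g \<in> carrier G. c g \<otimes>\<^bsub>U\<^esub> d g)"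
proof -
  have "(inv\<^bsub>U\<^esub> c g \<otimes>\<^bsub>U\<^esub> inv\<^bsub>U\<^esub> c (s g)) \<otimes>\<^bsub>U\<^esub> (inv\<^bsub>U\<^esub> d g \<otimes>\<^bsub>U\<^esub> inv\<^bsub>U\<^esub> d (s g))
      = inv\<^bsub>U\<^esub> (c g \<otimes>\<^bsub>U\<^esub> d g) \<otimes>\<^bsub>U\<^esub> inv\<^bsub>U\<^esub> (c (s g) \<otimes>\<^bsub>U\<^esub> d (s g))"
    if "g \<in> carrier G" for g
    using that assms funcset_mem[OF assms(1)] funcset_mem[OF assms(2)]
    by (simp add: A.inv_mult A.m_ac)
  then show ?thesis
    using assms by (auto simp: ext_coboundary_def mult_ext_Z2 coboundary_mult)
qed

text \<open>The first component is invariant under \<open>s\<close> because \<open>s\<close> is an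
  involution. In the relation between the components all values of \<open>c\<close> at
  \<open>g\<close>, \<open>u\<close>, \<open>s g\<close> and \<open>s u\<close> cancel; the inverses
  of \<open>c\<close> at the product and at its image under \<open>s\<close> remain.\<close>

lemma ext_coboundary_in_ext_Z2:
  assumes "c \<in> carrier G \<rightarrow> carrier U" and "c \<one>\<^bsub>G\<^esub> = \<one>\<^bsub>U\<^esub>"
  shows "ext_coboundary c \<in> carrier (ext_Z2 K G s)"
  unfolding ext_coboundary_def ext_Z2_iff
proof (intro conjI ballI)
  have c: "c g \<in> carrier U" if "g \<in> carrier G" for g
    using assms that by auto
  show "(\<lambda>g \<in> carrier G. inv\<^bsub>U\<^esub> c g \<otimes>\<^bsub>U\<^esub> inv\<^bsub>U\<^esub> c (s g)) \<in> carrier G \<rightarrow>\<^sub>E carrier U"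
    using c by auto
  show "coboundary c \<in> carrier (schur_Z2 K G)"
    by (rule coboundary_in_grp_Z2[OF assms(1)])
  show "(\<lambda>g \<in> carrier G. inv\<^bsub>U\<^esub> c g \<otimes>\<^bsub>U\<^esub> inv\<^bsub>U\<^esub> c (s g)) \<one>\<^bsub>G\<^esub> = \<one>\<^bsub>U\<^esub>"
    using assms(2) by (simp add: s_one)
  fix g assume g: "g \<in> carrier G"
  show "coboundary c (\<one>\<^bsub>G\<^esub>, g) = \<one>\<^bsub>U\<^esub>" "coboundary c (g, \<one>\<^bsub>G\<^esub>) = \<one>\<^bsub>U\<^esub>"
    using g c assms(2) by (simp_all add: coboundary_apply)
  show "(\<lambda>g \<in> carrier G. inv\<^bsub>U\<^esub> c g \<otimes>\<^bsub>U\<^esub> inv\<^bsub>U\<^esub> c (s g)) (s g)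
      = (\<lambda>g \<in> carrier G. inv\<^bsub>U\<^esub> c g \<otimes>\<^bsub>U\<^esub> inv\<^bsub>U\<^esub> c (s g)) g"
    using g c by (simp add: s_invol A.m_comm)
  fix u assume u: "u \<in> carrier G"
  let ?p = "c g" and ?q = "c u" and ?p' = "c (s g)" and ?q' = "c (s u)"
    and ?w = "c (g \<otimes>\<^bsub>G\<^esub> u)" and ?w' = "c (s g \<otimes>\<^bsub>G\<^esub> s u)"
  have cl: "?p \<in> carrier U" "?q \<in> carrier U" "?p' \<in> carrier U" "?q' \<in> carrier U"
    "?w \<in> carrier U" "?w' \<in> carrier U"
    using g u c by auto
  have "(?q \<otimes>\<^bsub>U\<^esub> inv\<^bsub>U\<^esub> ?w \<otimes>\<^bsub>U\<^esub> ?p) \<otimes>\<^bsub>U\<^esub> (?q' \<otimes>\<^bsub>U\<^esub> inv\<^bsub>U\<^esub> ?w' \<otimes>\<^bsub>U\<^esub> ?p')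
        \<otimes>\<^bsub>U\<^esub> (inv\<^bsub>U\<^esub> ?p \<otimes>\<^bsub>U\<^esub> inv\<^bsub>U\<^esub> ?p') \<otimes>\<^bsub>U\<^esub> (inv\<^bsub>U\<^esub> ?q \<otimes>\<^bsub>U\<^esub> inv\<^bsub>U\<^esub> ?q')
      = (inv\<^bsub>U\<^esub> ?w \<otimes>\<^bsub>U\<^esub> inv\<^bsub>U\<^esub> ?w') \<otimes>\<^bsub>U\<^esub> (?p \<otimes>\<^bsub>U\<^esub> inv\<^bsub>U\<^esub> ?p) \<otimes>\<^bsub>U\<^esub> (?p' \<otimes>\<^bsub>U\<^esub> inv\<^bsub>U\<^esub> ?p')
        \<otimes>\<^bsub>U\<^esub> (?q \<otimes>\<^bsub>U\<^esub> inv\<^bsub>U\<^esub> ?q) \<otimes>\<^bsub>U\<^esub> (?q' \<otimes>\<^bsub>U\<^esub> inv\<^bsub>U\<^esub> ?q')"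
    using cl by (simp only: A.m_ac A.m_closed A.inv_closed)
  also have "\<dots> = inv\<^bsub>U\<^esub> ?w \<otimes>\<^bsub>U\<^esub> inv\<^bsub>U\<^esub> ?w'"
    using cl by simp
  finally show "(\<lambda>g \<in> carrier G. inv\<^bsub>U\<^esub> c g \<otimes>\<^bsub>U\<^esub> inv\<^bsub>U\<^esub> c (s g)) (g \<otimes>\<^bsub>G\<^esub> u)
      = coboundary c (g, u) \<otimes>\<^bsub>U\<^esub> coboundary c (s g, s u)
        \<otimes>\<^bsub>U\<^esub> (\<lambda>g \<in> carrier G. inv\<^bsub>U\<^esub> c g \<otimes>\<^bsub>U\<^esub> inv\<^bsub>U\<^esub> c (s g)) g
        \<otimes>\<^bsub>U\<^esub> (\<lambda>g \<in> carrier G. inv\<^bsub>U\<^esub> c g \<otimes>\<^bsub>U\<^esub> inv\<^bsub>U\<^esub> c (s g)) u"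
    using g u by (simp add: coboundary_apply s_mult)
qed

lemma one_ext_Z2: "\<one>\<^bsub>ext_Z2 K G s\<^esub> = ext_coboundary (\<lambda>_ \<in> carrier G. \<one>\<^bsub>U\<^esub>)"
  by (auto simp: ext_coboundary_def coboundary_def ext_Z2_def fun_eq_iff)

lemma subgroup_ext_B2: "subgroup (ext_B2 K G s) (ext_Z2 K G s)"
proof -
  interpret E: comm_group "ext_Z2 K G s"
    by (rule comm_group_ext_Z2)
  show ?thesis
  proof (rule E.subgroupI)
    show "ext_B2 K G s \<subseteq> carrier (ext_Z2 K G s)"
      using ext_coboundary_in_ext_Z2 by (auto simp: ext_B2_eq PiE_def)
    show "ext_B2 K G s \<noteq> {}"
      unfolding ext_B2_eq by (auto intro!: exI[of _ "\<lambda>_ \<in> carrier G. \<one>\<^bsub>U\<^esub>"])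
  next
    fix p assume "p \<in> ext_B2 K G s"
    then obtain c where c: "c \<in> carrier G \<rightarrow>\<^sub>E carrier U" "c \<one>\<^bsub>G\<^esub> = \<one>\<^bsub>U\<^esub>" "p = ext_coboundary c"
      by (auto simp: ext_B2_eq)
    let ?d = "\<lambda>g \<in> carrier G. inv\<^bsub>U\<^esub> c g"
    have d: "?d \<in> carrier G \<rightarrow>\<^sub>E carrier U" "?d \<one>\<^bsub>G\<^esub> = \<one>\<^bsub>U\<^esub>"
      using c by auto
    have "(\<lambda>g \<in> carrier G. ?d g \<otimes>\<^bsub>U\<^esub> c g) = (\<lambda>g \<in> carrier G. \<one>\<^bsub>U\<^esub>)"
      using PiE_mem[OF c(1)] by (intro restrict_ext) simp
    then have "ext_coboundary ?d \<otimes>\<^bsub>ext_Z2 K G s\<^esub> p = \<one>\<^bsub>ext_Z2 K G s\<^esub>"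
      using c d ext_coboundary_mult[of ?d c] by (simp add: PiE_def one_ext_Z2)
    then have "inv\<^bsub>ext_Z2 K G s\<^esub> p = ext_coboundary ?d"
      using c d by (intro E.inv_equality) (auto intro!: ext_coboundary_in_ext_Z2)
    then show "inv\<^bsub>ext_Z2 K G s\<^esub> p \<in> ext_B2 K G s"
      unfolding ext_B2_eq using d by blast
  next
    fix p q assume "p \<in> ext_B2 K G s" "q \<in> ext_B2 K G s"
    then obtain c d where c: "c \<in> carrier G \<rightarrow>\<^sub>E carrier U" "c \<one>\<^bsub>G\<^esub> = \<one>\<^bsub>U\<^esub>" "p = ext_coboundary c"
      and d: "d \<in> carrier G \<rightarrow>\<^sub>E carrier U" "d \<one>\<^bsub>G\<^esub> = \<one>\<^bsub>U\<^esub>" "q = ext_coboundary d"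
      by (auto simp: ext_B2_eq)
    have "p \<otimes>\<^bsub>ext_Z2 K G s\<^esub> q = ext_coboundary (\<lambda>g \<in> carrier G. c g \<otimes>\<^bsub>U\<^esub> d g)"
      using c d by (simp add: ext_coboundary_mult PiE_def)
    moreover have "(\<lambda>g \<in> carrier G. c g \<otimes>\<^bsub>U\<^esub> d g)
        \<in> {c \<in> carrier G \<rightarrow>\<^sub>E carrier U. c \<one>\<^bsub>G\<^esub> = \<one>\<^bsub>U\<^esub>}"
      using c d by auto
    ultimately show "p \<otimes>\<^bsub>ext_Z2 K G s\<^esub> q \<in> ext_B2 K G s"
      unfolding ext_B2_eq by blast
  qed
qed

subsection \<open>Comparison with the cohomology of characters and the Schur multiplier\<close>

lemma char_group_iff:
  "\<beta> \<in> carrier (char_group K G) \<longleftrightarrow> \<beta> \<in> carrier G \<rightarrow>\<^sub>E carrier U \<and>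
    (\<forall>g \<in> carrier G. \<forall>u \<in> carrier G. \<beta> (g \<otimes>\<^bsub>G\<^esub> u) = \<beta> g \<otimes>\<^bsub>U\<^esub> \<beta> u)"
  by (auto simp: char_group_def hom_def PiE_def)

lemma char_groupD:
  assumes "\<beta> \<in> carrier (char_group K G)"
  shows "\<beta> \<in> carrier G \<rightarrow>\<^sub>E carrier U" and "\<And>g. g \<in> carrier G \<Longrightarrow> \<beta> g \<in> carrier U"
    and "\<And>g u. \<lbrakk>g \<in> carrier G; u \<in> carrier G\<rbrakk> \<Longrightarrow> \<beta> (g \<otimes>\<^bsub>G\<^esub> u) = \<beta> g \<otimes>\<^bsub>U\<^esub> \<beta> u"
    and "\<beta> \<in> hom G U"
proof -
  show 1: "\<beta> \<in> carrier G \<rightarrow>\<^sub>E carrier U"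
    using assms by (simp add: char_group_iff)
  show "\<beta> g \<in> carrier U" if "g \<in> carrier G" for g
    using that by (rule PiE_mem[OF 1])
  show "\<beta> (g \<otimes>\<^bsub>G\<^esub> u) = \<beta> g \<otimes>\<^bsub>U\<^esub> \<beta> u" if "g \<in> carrier G" "u \<in> carrier G" for g u
    using assms that by (simp add: char_group_iff)
  show "\<beta> \<in> hom G U"
    using assms by (simp add: char_group_def)
qed

lemma subgroup_char_group:
  "subgroup (carrier (char_group K G)) (product_group (carrier G) (\<lambda>_. U))"
proof (rule group.subgroupI)
  show "group (product_group (carrier G) (\<lambda>_. U))"
    by simp
  show "carrier (char_group K G) \<subseteq> carrier (product_group (carrier G) (\<lambda>_. U))"
    using char_groupD(1) by auto
  have "(\<lambda>_ \<in> carrier G. \<one>\<^bsub>U\<^esub>) \<in> carrier (char_group K G)"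
    by (simp add: char_group_iff)
  then show "carrier (char_group K G) \<noteq> {}"
    by blast
  fix \<beta> assume \<beta>: "\<beta> \<in> carrier (char_group K G)"
  note b = char_groupD[OF \<beta>]
  show "inv\<^bsub>product_group (carrier G) (\<lambda>_. U)\<^esub> \<beta> \<in> carrier (char_group K G)"
    using b(1-3) by (simp add: char_group_iff A.inv_mult)
  fix \<gamma> assume \<gamma>: "\<gamma> \<in> carrier (char_group K G)"
  note c = char_groupD[OF \<gamma>]
  show "\<beta> \<otimes>\<^bsub>product_group (carrier G) (\<lambda>_. U)\<^esub> \<gamma> \<in> carrier (char_group K G)"
    using b(2-3) c(2-3) by (simp add: char_group_iff A.m_ac)
qed

lemma char_group_eq:
  "char_group K G = product_group (carrier G) (\<lambda>_. U)\<lparr>carrier := carrier (char_group K G)\<rparr>"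
  by (simp add: char_group_def)

lemma comm_group_char_group: "comm_group (char_group K G)"
  using comm_group.subgroup_imp_comm_group[OF comm_group_product_group subgroup_char_group]
    A.comm_group_axioms char_group_eq by simp

lemma mult_char_group: "\<beta> \<otimes>\<^bsub>char_group K G\<^esub> \<gamma> = (\<lambda>g \<in> carrier G. \<beta> g \<otimes>\<^bsub>U\<^esub> \<gamma> g)"
  by (simp add: char_group_def)

lemma inv_char_group:
  assumes "\<beta> \<in> carrier (char_group K G)"
  shows "inv\<^bsub>char_group K G\<^esub> \<beta> = (\<lambda>g \<in> carrier G. inv\<^bsub>U\<^esub> \<beta> g)"
proof -
  have "inv\<^bsub>char_group K G\<^esub> \<beta> = inv\<^bsub>product_group (carrier G) (\<lambda>_. U)\<^esub> \<beta>"
    using group.m_inv_consistent[OF _ subgroup_char_group assms] char_group_eq by simp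
  then show ?thesis
    using char_groupD(1)[OF assms] by simp
qed

lemma char_pullback_hom:
  assumes f: "f \<in> hom G G"
  shows "(\<lambda>\<beta>. \<lambda>g \<in> carrier G. \<beta> (f g)) \<in> hom (char_group K G) (char_group K G)"
proof (rule homI)
  have fc: "f g \<in> carrier G" if "g \<in> carrier G" for g
    using f that hom_in_carrier by metis
  have fm: "f (g \<otimes>\<^bsub>G\<^esub> u) = f g \<otimes>\<^bsub>G\<^esub> f u" if "g \<in> carrier G" "u \<in> carrier G" for g u
    using f that hom_mult by metis
  fix \<beta> assume \<beta>: "\<beta> \<in> carrier (char_group K G)"
  note b = char_groupD[OF \<beta>]
  show "(\<lambda>g \<in> carrier G. \<beta> (f g)) \<in> carrier (char_group K G)"
    using b(2,3) fc fm by (simp add: char_group_iff)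
  fix \<gamma> assume \<gamma>: "\<gamma> \<in> carrier (char_group K G)"
  show "(\<lambda>g \<in> carrier G. (\<beta> \<otimes>\<^bsub>char_group K G\<^esub> \<gamma>) (f g))
      = (\<lambda>g \<in> carrier G. \<beta> (f g)) \<otimes>\<^bsub>char_group K G\<^esub> (\<lambda>g \<in> carrier G. \<gamma> (f g))"
    using fc by (auto simp: mult_char_group)
qed

text \<open>The order of \<open>G\<close> annihilates every element of \<open>G\<close>, so
  characters take values in the roots of unity of that order, and \<open>G\<close> is
  finite.\<close>

lemma finite_char_group:
  assumes fin: "finite (carrier G)"
    and torsion: "finite {x \<in> carrier U. x [^]\<^bsub>U\<^esub> order G = \<one>\<^bsub>U\<^esub>}" (is "finite ?T")
  shows "finite (carrier (char_group K G))"
proof (rule finite_subset)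
  show "carrier (char_group K G) \<subseteq> carrier G \<rightarrow>\<^sub>E ?T"
  proof
    fix \<beta> assume \<beta>: "\<beta> \<in> carrier (char_group K G)"
    note b = char_groupD[OF \<beta>]
    interpret \<beta>: group_hom G U \<beta>
      using b(4) by unfold_locales
    have "\<beta> g [^]\<^bsub>U\<^esub> order G = \<one>\<^bsub>U\<^esub>" if "g \<in> carrier G" for g
      using \<beta>.hom_nat_pow[OF that, of "order G"] L.pow_order_eq_1[OF that] by simp
    then show "\<beta> \<in> carrier G \<rightarrow>\<^sub>E ?T"
      using b(1) by (simp add: PiE_iff)
  qed
  show "finite (carrier G \<rightarrow>\<^sub>E ?T)"
    using assms by (intro finite_PiE)
qed

section \<open>Extension cocycles with trivial class of the second component\<close>

lemma ext_Z2_kernel: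
  assumes p: "(\<sigma>, \<tau>) \<in> carrier (ext_Z2 K G s)" and \<tau>: "\<tau> \<in> schur_B2 K G"
  shows "\<exists>\<rho>. (\<rho>, \<one>\<^bsub>schur_Z2 K G\<^esub>) \<in> carrier (ext_Z2 K G s) \<and>
    (\<sigma>, \<tau>) \<otimes>\<^bsub>ext_Z2 K G s\<^esub> inv\<^bsub>ext_Z2 K G s\<^esub> (\<rho>, \<one>\<^bsub>schur_Z2 K G\<^esub>) \<in> ext_B2 K G s"
proof -
  interpret E: comm_group "ext_Z2 K G s"
    by (rule comm_group_ext_Z2)
  interpret Z: comm_group "schur_Z2 K G"
    by (rule comm_group_grp_Z2)
  obtain c where c: "c \<in> carrier G \<rightarrow>\<^sub>E carrier U" "\<tau> = coboundary c"
    using \<tau> unfolding grp_B2_eq by blast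
  \<comment> \<open>The coboundary of \<open>c\<close> takes the value of \<open>c\<close> at the
    unit on the pair of units. Thus the normalisation of \<open>\<tau>\<close> supplies the one that
    \<open>ext_B2\<close> demands of \<open>c\<close>.\<close>
  have "\<tau> (\<one>\<^bsub>G\<^esub>, \<one>\<^bsub>G\<^esub>) = \<one>\<^bsub>U\<^esub>"
    using p unfolding ext_Z2_iff by blast
  moreover have "c \<one>\<^bsub>G\<^esub> \<in> carrier U"
    using c by auto
  ultimately have c_one: "c \<one>\<^bsub>G\<^esub> = \<one>\<^bsub>U\<^esub>"
    by (simp add: c coboundary_apply)
  \<comment> \<open>This element of \<open>ext_B2\<close> has second component
    \<open>\<tau>\<close>, so dividing by it leaves a pair with trivial second component.\<close>
  let ?b = "ext_coboundary c"
  have b: "?b \<in> ext_B2 K G s"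
    unfolding ext_B2_eq using c c_one by blast
  then have bZ: "?b \<in> carrier (ext_Z2 K G s)"
    using subgroup.mem_carrier[OF subgroup_ext_B2] by blast
  then obtain \<rho> where \<rho>: "(\<sigma>, \<tau>) \<otimes>\<^bsub>ext_Z2 K G s\<^esub> inv\<^bsub>ext_Z2 K G s\<^esub> ?b
      = (\<rho>, \<tau> \<otimes>\<^bsub>schur_Z2 K G\<^esub> inv\<^bsub>schur_Z2 K G\<^esub> \<tau>)"
    unfolding ext_coboundary_def c(2)[symmetric] by (simp add: inv_ext_Z2 mult_ext_Z2)
  have "\<tau> \<otimes>\<^bsub>schur_Z2 K G\<^esub> inv\<^bsub>schur_Z2 K G\<^esub> \<tau> = \<one>\<^bsub>schur_Z2 K G\<^esub>"
    using ext_Z2D(2)[OF p] by (rule Z.r_inv)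
  with \<rho> have \<rho>: "(\<sigma>, \<tau>) \<otimes>\<^bsub>ext_Z2 K G s\<^esub> inv\<^bsub>ext_Z2 K G s\<^esub> ?b = (\<rho>, \<one>\<^bsub>schur_Z2 K G\<^esub>)"
    by simp
  \<comment> \<open>The pair with first component \<open>\<rho>\<close> is
    \<open>(\<sigma>, \<tau>)\<close> divided by \<open>?b\<close>; dividing
    \<open>(\<sigma>, \<tau>)\<close> by that pair gives \<open>?b\<close> back.\<close>
  have "(\<sigma>, \<tau>) \<otimes>\<^bsub>ext_Z2 K G s\<^esub> inv\<^bsub>ext_Z2 K G s\<^esub> (\<rho>, \<one>\<^bsub>schur_Z2 K G\<^esub>) = ?b"
    unfolding \<rho>[symmetric] using p bZ by (simp add: E.inv_mult E.m_assoc[symmetric])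
  moreover have "(\<rho>, \<one>\<^bsub>schur_Z2 K G\<^esub>) \<in> carrier (ext_Z2 K G s)"
    unfolding \<rho>[symmetric] using p bZ by simp
  ultimately show ?thesis
    using b by (intro exI[of _ \<rho>]) simp
qed

text \<open>With trivial second component the relation between the components says that
  \<open>\<rho>\<close> is multiplicative. Invariance under \<open>s\<close> extends to an equality
  of functions because both sides are \<open>undefined\<close> off the carrier.\<close>

lemma ext_Z2_kernel_char:
  assumes "(\<rho>, \<one>\<^bsub>schur_Z2 K G\<^esub>) \<in> carrier (ext_Z2 K G s)"
  shows "\<rho> \<in> carrier (char_group K G)" and "(\<lambda>g \<in> carrier G. \<rho> (s g)) = \<rho>"
proof -
  have one: "\<one>\<^bsub>schur_Z2 K G\<^esub> = (\<lambda>_ \<in> carrier G \<times> carrier G. \<one>\<^bsub>U\<^esub>)"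
    by (simp add: grp_Z2_def)
  note \<rho> = ext_Z2D(1)[OF assms] assms[unfolded ext_Z2_iff]
  have \<rho>c: "\<rho> g \<in> carrier U" if "g \<in> carrier G" for g
    using that by (rule PiE_mem[OF \<rho>(1)])
  then show "\<rho> \<in> carrier (char_group K G)"
    using \<rho> by (simp add: char_group_iff one)
  show "(\<lambda>g \<in> carrier G. \<rho> (s g)) = \<rho>"
  proof
    fix g
    show "(\<lambda>g \<in> carrier G. \<rho> (s g)) g = \<rho> g"
      using \<rho> PiE_arb[OF \<rho>(1)] by (cases "g \<in> carrier G") auto
  qed
qed

text \<open>A character has trivial coboundary, and so does its inverse. Hence the pointwise inverse
  of \<open>\<beta>\<close>, used as the cochain in \<open>ext_coboundary\<close>, gives the norm of
  \<open>\<beta>\<close> paired with the trivial cocycle, which is the quotient in question.\<close>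

lemma ext_Z2_kernel_norm:
  assumes k: "(\<rho>, \<one>\<^bsub>schur_Z2 K G\<^esub>) \<in> carrier (ext_Z2 K G s)"
    and l: "(\<rho>', \<one>\<^bsub>schur_Z2 K G\<^esub>) \<in> carrier (ext_Z2 K G s)"
    and \<beta>: "\<beta> \<in> carrier (char_group K G)"
    and eq: "\<rho> \<otimes>\<^bsub>char_group K G\<^esub> inv\<^bsub>char_group K G\<^esub> \<rho>'
      = (\<lambda>g \<in> carrier G. \<beta> (s g)) \<otimes>\<^bsub>char_group K G\<^esub> \<beta>"
  shows "(\<rho>, \<one>\<^bsub>schur_Z2 K G\<^esub>) \<otimes>\<^bsub>ext_Z2 K G s\<^esub> inv\<^bsub>ext_Z2 K G s\<^esub> (\<rho>', \<one>\<^bsub>schur_Z2 K G\<^esub>)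
    \<in> ext_B2 K G s"
proof -
  interpret Z: comm_group "schur_Z2 K G"
    by (rule comm_group_grp_Z2)
  note b = char_groupD[OF \<beta>]
  let ?c = "\<lambda>g \<in> carrier G. inv\<^bsub>U\<^esub> \<beta> g"
  have \<beta>_one: "\<beta> \<one>\<^bsub>G\<^esub> = \<one>\<^bsub>U\<^esub>"
    using hom_one[OF b(4) L.is_group A.is_group] .
  have c: "?c \<in> carrier G \<rightarrow>\<^sub>E carrier U" "?c \<one>\<^bsub>G\<^esub> = \<one>\<^bsub>U\<^esub>"
    using b(2) \<beta>_one by auto
  have "coboundary ?c = (\<lambda>_ \<in> carrier G \<times> carrier G. \<one>\<^bsub>U\<^esub>)"
  proof (rule extensionalityI[where A = "carrier G \<times> carrier G"])
    fix p assume "p \<in> carrier G \<times> carrier G"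
    then obtain g u where p: "p = (g, u)" and gu: "g \<in> carrier G" "u \<in> carrier G"
      by auto
    have "inv\<^bsub>U\<^esub> \<beta> u \<otimes>\<^bsub>U\<^esub> (\<beta> g \<otimes>\<^bsub>U\<^esub> \<beta> u) \<otimes>\<^bsub>U\<^esub> inv\<^bsub>U\<^esub> \<beta> g
        = (\<beta> u \<otimes>\<^bsub>U\<^esub> inv\<^bsub>U\<^esub> \<beta> u) \<otimes>\<^bsub>U\<^esub> (\<beta> g \<otimes>\<^bsub>U\<^esub> inv\<^bsub>U\<^esub> \<beta> g)"
      using b(2) gu by (simp only: A.m_ac A.m_closed A.inv_closed)
    then show "coboundary ?c p = (\<lambda>_ \<in> carrier G \<times> carrier G. \<one>\<^bsub>U\<^esub>) p"
      using b(2,3) gu by (simp add: p coboundary_apply)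
  qed (auto simp: coboundary_def)
  then have "coboundary ?c = \<one>\<^bsub>schur_Z2 K G\<^esub>"
    by (simp add: grp_Z2_def)
  then have "ext_coboundary ?c = (\<lambda>g \<in> carrier G. \<beta> g \<otimes>\<^bsub>U\<^esub> \<beta> (s g), \<one>\<^bsub>schur_Z2 K G\<^esub>)"
    using b(2) by (simp add: ext_coboundary_def cong: restrict_cong)
  also have "(\<lambda>g \<in> carrier G. \<beta> g \<otimes>\<^bsub>U\<^esub> \<beta> (s g)) = (\<lambda>g \<in> carrier G. \<beta> (s g)) \<otimes>\<^bsub>char_group K G\<^esub> \<beta>"
    using b(2) by (auto simp: mult_char_group A.m_comm)
  also have "\<dots> = (\<lambda>g \<in> carrier G. \<rho> g \<otimes>\<^bsub>U\<^esub> inv\<^bsub>U\<^esub> \<rho>' g)"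
    unfolding eq[symmetric] by (auto simp: mult_char_group inv_char_group[OF ext_Z2_kernel_char(1)[OF l]])
  also have "(\<lambda>g \<in> carrier G. \<rho> g \<otimes>\<^bsub>U\<^esub> inv\<^bsub>U\<^esub> \<rho>' g, \<one>\<^bsub>schur_Z2 K G\<^esub>)
      = (\<rho>, \<one>\<^bsub>schur_Z2 K G\<^esub>) \<otimes>\<^bsub>ext_Z2 K G s\<^esub> inv\<^bsub>ext_Z2 K G s\<^esub> (\<rho>', \<one>\<^bsub>schur_Z2 K G\<^esub>)"
    by (auto simp: inv_ext_Z2[OF l] mult_ext_Z2)
  finally have "ext_coboundary ?c
      = (\<rho>, \<one>\<^bsub>schur_Z2 K G\<^esub>) \<otimes>\<^bsub>ext_Z2 K G s\<^esub> inv\<^bsub>ext_Z2 K G s\<^esub> (\<rho>', \<one>\<^bsub>schur_Z2 K G\<^esub>)" .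
  moreover have "ext_coboundary ?c \<in> ext_B2 K G s"
    unfolding ext_B2_eq using c by blast
  ultimately show ?thesis
    by simp
qed

section \<open>The map to the Schur multiplier and the count of its fibres\<close>

lemma cocycle_act_in_schur_Z2:
  assumes "\<tau> \<in> carrier (schur_Z2 K G)"
  shows "cocycle_act G s \<tau> \<in> carrier (schur_Z2 K G)"
proof -
  have "\<tau> (s x, s y) \<otimes>\<^bsub>U\<^esub> \<tau> (s x \<otimes>\<^bsub>G\<^esub> s y, s z) = \<tau> (s x, s y \<otimes>\<^bsub>G\<^esub> s z) \<otimes>\<^bsub>U\<^esub> \<tau> (s y, s z)"
    if "x \<in> carrier G" "y \<in> carrier G" "z \<in> carrier G" for x y z
    using assms that unfolding grp_Z2_iff by (meson s_closed)
  then show ?thesis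
    using grp_Z2_closed[OF assms] by (simp add: grp_Z2_iff cocycle_act_def s_mult Pi_iff)
qed

text \<open>Solving the relation between the components for the two values of \<open>\<tau>\<close>
  displays their product as the coboundary of the pointwise inverse of
  \<open>\<sigma>\<close>.\<close>

lemma cocycle_act_mult_in_schur_B2:
  assumes p: "(\<sigma>, \<tau>) \<in> carrier (ext_Z2 K G s)"
  shows "cocycle_act G s \<tau> \<otimes>\<^bsub>schur_Z2 K G\<^esub> \<tau> \<in> schur_B2 K G"
proof -
  have \<sigma>: "\<sigma> g \<in> carrier U" if "g \<in> carrier G" for g
    using that by (rule PiE_mem[OF ext_Z2D(1)[OF p]])
  note \<tau> = grp_Z2_closed[OF ext_Z2D(2)[OF p]]
  let ?c = "\<lambda>g \<in> carrier G. inv\<^bsub>U\<^esub> \<sigma> g"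
  have "cocycle_act G s \<tau> \<otimes>\<^bsub>schur_Z2 K G\<^esub> \<tau> = coboundary ?c"
    unfolding mult_grp_Z2
  proof (rule extensionalityI[where A = "carrier G \<times> carrier G"])
    fix q assume "q \<in> carrier G \<times> carrier G"
    then obtain g u where q: "q = (g, u)" and gu: "g \<in> carrier G" "u \<in> carrier G"
      by auto
    have rel: "\<sigma> (g \<otimes>\<^bsub>G\<^esub> u) = \<tau> (g, u) \<otimes>\<^bsub>U\<^esub> \<tau> (s g, s u) \<otimes>\<^bsub>U\<^esub> \<sigma> g \<otimes>\<^bsub>U\<^esub> \<sigma> u"
      using p gu unfolding ext_Z2_iff by blast
    have cl: "\<sigma> g \<in> carrier U" "\<sigma> u \<in> carrier U" "\<tau> (g, u) \<in> carrier U" "\<tau> (s g, s u) \<in> carrier U"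
      using \<sigma> \<tau> gu by simp_all
    have "coboundary ?c (g, u) = inv\<^bsub>U\<^esub> \<sigma> u \<otimes>\<^bsub>U\<^esub> \<sigma> (g \<otimes>\<^bsub>G\<^esub> u) \<otimes>\<^bsub>U\<^esub> inv\<^bsub>U\<^esub> \<sigma> g"
      using gu \<sigma> by (simp add: coboundary_apply)
    also have "\<dots> = (\<tau> (s g, s u) \<otimes>\<^bsub>U\<^esub> \<tau> (g, u)) \<otimes>\<^bsub>U\<^esub> (\<sigma> u \<otimes>\<^bsub>U\<^esub> inv\<^bsub>U\<^esub> \<sigma> u)
        \<otimes>\<^bsub>U\<^esub> (\<sigma> g \<otimes>\<^bsub>U\<^esub> inv\<^bsub>U\<^esub> \<sigma> g)"
      unfolding rel using cl by (simp only: A.m_ac A.m_closed A.inv_closed)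
    also have "\<dots> = \<tau> (s g, s u) \<otimes>\<^bsub>U\<^esub> \<tau> (g, u)"
      using cl by simp
    finally show "(\<lambda>p \<in> carrier G \<times> carrier G. cocycle_act G s \<tau> p \<otimes>\<^bsub>U\<^esub> \<tau> p) q = coboundary ?c q"
      using gu by (simp add: q cocycle_act_def)
  qed (auto simp: coboundary_def)
  moreover have "?c \<in> carrier G \<rightarrow>\<^sub>E carrier U"
    using \<sigma> by simp
  ultimately show ?thesis
    unfolding grp_B2_eq by blast
qed

text \<open>The inverse of a class is the class of the inverse cocycle, so membership in the minus
  part amounts to \<open>cocycle_act G s \<tau>\<close> times \<open>\<tau>\<close> being a
  coboundary.\<close>

lemma schur_class_in_schur_mult_minus:
  assumes p: "(\<sigma>, \<tau>) \<in> carrier (ext_Z2 K G s)"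
  shows "schur_class K G \<tau> \<in> schur_mult_minus K G s"
proof -
  interpret Z: comm_group "schur_Z2 K G"
    by (rule comm_group_grp_Z2)
  note \<tau> = ext_Z2D(2)[OF p]
  interpret B: normal "schur_B2 K G" "schur_Z2 K G"
    using Z.subgroup_imp_normal[OF subgroup_grp_B2] .
  have "schur_class K G \<tau> \<in> carrier (schur_mult K G)"
    using \<tau> by (auto simp: schur_mult_def grp_H2_def carrier_FactGroup schur_class_def)
  then have "inv\<^bsub>schur_mult K G\<^esub> (schur_class K G \<tau>)
      = schur_B2 K G #>\<^bsub>schur_Z2 K G\<^esub> inv\<^bsub>schur_Z2 K G\<^esub> \<tau>"
    unfolding schur_mult_def grp_H2_def
    by (simp add: B.inv_FactGroup schur_class_def B.rcos_inv[OF \<tau>])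
  moreover have "schur_class K G (cocycle_act G s \<tau>)
      = schur_B2 K G #>\<^bsub>schur_Z2 K G\<^esub> inv\<^bsub>schur_Z2 K G\<^esub> \<tau>"
    unfolding schur_class_def
    using \<tau> cocycle_act_mult_in_schur_B2[OF p] cocycle_act_in_schur_Z2[OF \<tau>]
    by (intro Z.rcos_eq_iff[OF subgroup_grp_B2, THEN iffD2]) simp_all
  ultimately show ?thesis
    unfolding schur_mult_minus_def using \<tau> by auto
qed

lemma schur_mult_minus_subset: "schur_mult_minus K G s \<subseteq> carrier (schur_mult K G)"
  by (auto simp: schur_mult_minus_def schur_mult_def grp_H2_def carrier_FactGroup schur_class_def)

text \<open>An instance of \<open>card_rcosets_le_mult\<close>: the base is the minus part of the
  Schur multiplier, reached by the class of the second component; \<open>F\<close> consists of the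
  pairs with trivial second component; \<open>h\<close> sends such a pair to the class of the cyclic
  cocycle of its first component. Finiteness of the two cohomology groups makes the cardinalities on
  the right genuine counts.\<close>

lemma ext_H2_le:
  assumes "order_two_action L (char_group K G) (char_act G \<phi>) t" and "\<phi> t = s"
    and "finite (carrier (grp_H2 L (char_group K G) (char_act G \<phi>)))"
    and "finite (carrier (schur_mult K G))"
  shows "finite (carrier (ext_H2 K G s)) \<and> order (ext_H2 K G s)
    \<le> order (grp_H2 L (char_group K G) (char_act G \<phi>)) * card (schur_mult_minus K G s)"
proof -
  interpret C: order_two_action L "char_group K G" "char_act G \<phi>" t
    by fact
  interpret H: comm_group "grp_Z2 L (char_group K G) (char_act G \<phi>)"
    by (rule C.comm_group_grp_Z2)
  interpret E: comm_group "ext_Z2 K G s"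
    by (rule comm_group_ext_Z2)
  interpret Z: comm_group "schur_Z2 K G"
    by (rule comm_group_grp_Z2)
  let ?HZ = "grp_Z2 L (char_group K G) (char_act G \<phi>)"
  let ?HB = "grp_B2 L (char_group K G) (char_act G \<phi>)"
  let ?F = "{p \<in> carrier (ext_Z2 K G s). snd p = \<one>\<^bsub>schur_Z2 K G\<^esub>}"
  let ?z = "cyclic_cocycle L (char_group K G) t"
  have char: "\<rho> \<in> carrier (char_group K G)" "char_act G \<phi> t \<rho> = \<rho>"
    if "(\<rho>, \<one>\<^bsub>schur_Z2 K G\<^esub>) \<in> carrier (ext_Z2 K G s)" for \<rho>
    using ext_Z2_kernel_char[OF that] assms(2) by (simp_all add: char_act_def)
  \<comment> \<open>A pair in \<open>?F\<close> has an invariant character as first component,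
    exactly the kind of element from which a cyclic cocycle can be formed.\<close>
  note z_closed = C.cyclic_cocycle_in_grp_Z2[OF char]
  have "finite (rcosets\<^bsub>ext_Z2 K G s\<^esub> ext_B2 K G s) \<and>
    card (rcosets\<^bsub>ext_Z2 K G s\<^esub> ext_B2 K G s) \<le> card (schur_mult_minus K G s) *
      card (carrier (grp_H2 L (char_group K G) (char_act G \<phi>)))"
  proof (rule E.card_rcosets_le_mult[OF subgroup_ext_B2, where F = ?F
        and P = "\<lambda>p. schur_class K G (snd p)" and h = "\<lambda>p. ?HB #>\<^bsub>?HZ\<^esub> ?z (fst p)"])
    show "?F \<subseteq> carrier (ext_Z2 K G s)"
      by blast
    show "finite (schur_mult_minus K G s)"
      using finite_subset[OF schur_mult_minus_subset] assms(4) .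
    show "finite (carrier (grp_H2 L (char_group K G) (char_act G \<phi>)))"
      by fact
    show "(\<lambda>p. schur_class K G (snd p)) \<in> carrier (ext_Z2 K G s) \<rightarrow> schur_mult_minus K G s"
      using schur_class_in_schur_mult_minus by force
    show "(\<lambda>p. ?HB #>\<^bsub>?HZ\<^esub> ?z (fst p)) \<in> ?F \<rightarrow> carrier (grp_H2 L (char_group K G) (char_act G \<phi>))"
      unfolding grp_H2_def carrier_FactGroup using z_closed by force
  next
    fix p q assume p: "p \<in> carrier (ext_Z2 K G s)" and q: "q \<in> carrier (ext_Z2 K G s)"
      and eq: "schur_class K G (snd p) = schur_class K G (snd q)"
    obtain \<sigma> \<tau> \<sigma>' \<tau>' where pq: "p = (\<sigma>, \<tau>)" "q = (\<sigma>', \<tau>')"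
      by fastforce
    have \<tau>: "\<tau> \<in> carrier (schur_Z2 K G)" "\<tau>' \<in> carrier (schur_Z2 K G)"
      using p q ext_Z2D(2) unfolding pq by blast+
    let ?r = "p \<otimes>\<^bsub>ext_Z2 K G s\<^esub> inv\<^bsub>ext_Z2 K G s\<^esub> q"
    have "?r \<in> carrier (ext_Z2 K G s)"
      using p q by simp
    moreover have "snd ?r = \<tau> \<otimes>\<^bsub>schur_Z2 K G\<^esub> inv\<^bsub>schur_Z2 K G\<^esub> \<tau>'"
      using q by (simp add: pq inv_ext_Z2 mult_ext_Z2)
    moreover have "\<tau> \<otimes>\<^bsub>schur_Z2 K G\<^esub> inv\<^bsub>schur_Z2 K G\<^esub> \<tau>' \<in> schur_B2 K G"
      using eq Z.rcos_eq_iff[OF subgroup_grp_B2 \<tau>] by (simp add: schur_class_def pq)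
    ultimately obtain \<rho> where "(\<rho>, \<one>\<^bsub>schur_Z2 K G\<^esub>) \<in> carrier (ext_Z2 K G s)"
      "?r \<otimes>\<^bsub>ext_Z2 K G s\<^esub> inv\<^bsub>ext_Z2 K G s\<^esub> (\<rho>, \<one>\<^bsub>schur_Z2 K G\<^esub>) \<in> ext_B2 K G s"
      using ext_Z2_kernel[of "fst ?r" "snd ?r"] by (metis prod.collapse)
    then show "\<exists>k \<in> ?F. ?r \<otimes>\<^bsub>ext_Z2 K G s\<^esub> inv\<^bsub>ext_Z2 K G s\<^esub> k \<in> ext_B2 K G s"
      by (intro bexI[of _ "(\<rho>, \<one>\<^bsub>schur_Z2 K G\<^esub>)"]) simp_all
  next
    fix k l assume "k \<in> ?F" "l \<in> ?F" and eq: "?HB #>\<^bsub>?HZ\<^esub> ?z (fst k) = ?HB #>\<^bsub>?HZ\<^esub> ?z (fst l)"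
    then obtain \<rho> \<rho>' where kl: "k = (\<rho>, \<one>\<^bsub>schur_Z2 K G\<^esub>)" "l = (\<rho>', \<one>\<^bsub>schur_Z2 K G\<^esub>)"
      and k: "(\<rho>, \<one>\<^bsub>schur_Z2 K G\<^esub>) \<in> carrier (ext_Z2 K G s)"
      and l: "(\<rho>', \<one>\<^bsub>schur_Z2 K G\<^esub>) \<in> carrier (ext_Z2 K G s)"
      by (cases k; cases l) auto
    have "?z \<rho> \<otimes>\<^bsub>?HZ\<^esub> inv\<^bsub>?HZ\<^esub> (?z \<rho>') \<in> ?HB"
      using eq H.rcos_eq_iff[OF C.subgroup_grp_B2 z_closed[OF k k] z_closed[OF l l]] by (simp add: kl)
    from C.cyclic_cocycle_quotient_in_grp_B2[OF char[OF k] char[OF l] this]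
    obtain \<beta> where "\<beta> \<in> carrier (char_group K G)"
      "\<rho> \<otimes>\<^bsub>char_group K G\<^esub> inv\<^bsub>char_group K G\<^esub> \<rho>' = char_act G \<phi> t \<beta> \<otimes>\<^bsub>char_group K G\<^esub> \<beta>"
      by blast
    then show "k \<otimes>\<^bsub>ext_Z2 K G s\<^esub> inv\<^bsub>ext_Z2 K G s\<^esub> l \<in> ext_B2 K G s"
      unfolding kl using k l assms(2) by (intro ext_Z2_kernel_norm) (simp_all add: char_act_def)
  qed
  then show ?thesis
    by (simp add: ext_H2_def FactGroup_def order_def mult.commute)
qed

end

section \<open>Groups of order two, actions by automorphisms, and the theorem\<close>

lemma order_two_generator:
  assumes "group L" and "order L = 2" and t: "t \<in> carrier L" and gen: "generate L {t} = carrier L"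
  shows "carrier L = {\<one>\<^bsub>L\<^esub>, t}" and "t \<noteq> \<one>\<^bsub>L\<^esub>" and "t \<otimes>\<^bsub>L\<^esub> t = \<one>\<^bsub>L\<^esub>"
proof -
  interpret L: group L
    by fact
  have card: "card (carrier L) = 2"
    using assms(2) by (simp add: order_def)
  then have fin: "finite (carrier L)"
    by (intro card_ge_0_finite) simp
  show t1: "t \<noteq> \<one>\<^bsub>L\<^esub>"
  proof
    assume "t = \<one>\<^bsub>L\<^esub>"
    then have "carrier L = {\<one>\<^bsub>L\<^esub>}"
      using gen L.generate_one by simp
    then show False
      using card by simp
  qed
  have "{\<one>\<^bsub>L\<^esub>, t} = carrier L"
    using t t1 card by (intro card_subset_eq[OF fin]) auto
  then show "carrier L = {\<one>\<^bsub>L\<^esub>, t}"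
    by simp
  have "t [^]\<^bsub>L\<^esub> (2 :: nat) = \<one>\<^bsub>L\<^esub>"
    using L.pow_order_eq_1[OF t] assms(2) by simp
  then show "t \<otimes>\<^bsub>L\<^esub> t = \<one>\<^bsub>L\<^esub>"
    using t by (simp add: numeral_2_eq_2)
qed

text \<open>Multiplication in \<open>AutoGroup G\<close> is composition restricted to the carrier,
  so the action laws are obtained at points of the carrier.\<close>

lemma AutoGroup_action:
  assumes "group_hom L (AutoGroup G) \<phi>"
  shows "x \<in> carrier L \<Longrightarrow> \<phi> x \<in> hom G G"
    and "g \<in> carrier G \<Longrightarrow> \<phi> \<one>\<^bsub>L\<^esub> g = g"
    and "\<lbrakk>x \<in> carrier L; y \<in> carrier L; g \<in> carrier G\<rbrakk> \<Longrightarrow> \<phi> (x \<otimes>\<^bsub>L\<^esub> y) g = \<phi> x (\<phi> y g)"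
proof -
  interpret group_hom L "AutoGroup G" \<phi>
    by fact
  have auto: "\<phi> x \<in> auto G" if "x \<in> carrier L" for x
    using hom_closed[OF that] by (simp add: AutoGroup_def)
  then show "x \<in> carrier L \<Longrightarrow> \<phi> x \<in> hom G G"
    by (simp add: auto_def)
  show "g \<in> carrier G \<Longrightarrow> \<phi> \<one>\<^bsub>L\<^esub> g = g"
    using hom_one by (simp add: AutoGroup_def BijGroup_def)
  show "\<phi> (x \<otimes>\<^bsub>L\<^esub> y) g = \<phi> x (\<phi> y g)"
    if "x \<in> carrier L" "y \<in> carrier L" "g \<in> carrier G"
    using hom_mult[OF that(1,2)] auto[OF that(1)] auto[OF that(2)] that(3)
    by (simp add: AutoGroup_def BijGroup_def auto_def compose_def)
qed

theorem corollary3p8: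
  fixes K :: "('k, 'c) ring_scheme"
    and G :: "('g, 'd) monoid_scheme"
    and L :: "('l, 'e) monoid_scheme"
    and \<phi> :: "'l \<Rightarrow> 'g \<Rightarrow> 'g"
    and t :: 'l
    and m :: nat
  assumes "algebraically_closed K"
    and "\<And>n :: nat. n > 0 \<Longrightarrow> [n] \<cdot>\<^bsub>K\<^esub> \<one>\<^bsub>K\<^esub> \<noteq> \<zero>\<^bsub>K\<^esub>"
    and "group G" and "m \<ge> 1" and "order G = 2 ^ (m - 1)"
    and "group L" and "order L = 2"
    and "t \<in> carrier L" and "generate L {t} = carrier L"
    and "group_hom L (AutoGroup G) \<phi>"
  shows "finite (carrier (ext_H2 K G (\<phi> t))) \<and>
    order (ext_H2 K G (\<phi> t))
      \<le> order (grp_H2 L (char_group K G) (char_act G \<phi>)) * card (schur_mult_minus K G (\<phi> t))"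
proof -
  interpret K: algebraically_closed K
    by fact
  interpret G: group G
    by fact
  interpret U: comm_group "units_of K"
    by (rule K.units_comm_group)
  note L = order_two_generator[OF assms(6-9)]
  note \<phi> = AutoGroup_action[OF assms(10)]
  have G_pos: "order G > 0"
    using assms(5) by simp
  then have G_fin: "finite (carrier G)"
    unfolding order_def by (rule card_ge_0_finite)
  have invol: "\<phi> t (\<phi> t g) = g" if "g \<in> carrier G" for g
    using \<phi>(3)[OF assms(8,8) that] \<phi>(2)[OF that] L(3) by simp
  interpret I: comm_group_action G "units_of K" "\<lambda>_ a. a"
    using U.comm_group_action_trivial[OF assms(3)] .
  interpret I: involution_cochains G K "\<phi> t"
    using \<phi>(1)[OF assms(8)] invol by unfold_locales
  note torsion = K.finite_roots_of_unity[OF G_pos]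
  \<comment> \<open>Algebraic closedness supplies the roots of degree \<open>order G\<close>, and
    the polynomial X^n - 1 has finitely many roots, which bounds the torsion.\<close>
  have schur: "finite (carrier (schur_mult K G))"
    unfolding schur_mult_def
    using G_fin torsion K.ex_nth_root[OF G_pos] by (intro I.finite_grp_H2_of_trivial_action) auto
  interpret C: comm_group "char_group K G"
    by (rule I.comm_group_char_group)
  interpret C: comm_group_action L "char_group K G" "char_act G \<phi>"
  proof (intro comm_group_action.intro comm_group_action_axioms.intro)
    show "char_act G \<phi> x \<in> hom (char_group K G) (char_group K G)" if "x \<in> carrier L" for x
      using I.char_pullback_hom[OF \<phi>(1)[OF that]] unfolding char_act_def .
    fix x y \<beta> assume xy: "x \<in> carrier L" "y \<in> carrier L"
    \<comment> \<open>Pulling back characters reverses the order of composition; commutativity of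
      the group of order two turns the result into a left action.\<close>
    then have "x \<otimes>\<^bsub>L\<^esub> y = y \<otimes>\<^bsub>L\<^esub> x"
      using L group.is_monoid[OF assms(6)] by (auto simp: monoid.l_one monoid.r_one)
    then show "char_act G \<phi> (x \<otimes>\<^bsub>L\<^esub> y) \<beta> = char_act G \<phi> x (char_act G \<phi> y \<beta>)"
      using xy \<phi>(1)[OF xy(1)] \<phi>(3)[OF xy(2,1)]
      by (auto simp: char_act_def hom_in_carrier fun_eq_iff)
  qed (fact assms(6) C.comm_group_axioms)+
  interpret C: order_two_action L "char_group K G" "char_act G \<phi>" t
  proof
    fix \<beta> assume "\<beta> \<in> carrier (char_group K G)"
    \<comment> \<open>Extensionality makes the restriction in \<open>char_act\<close> harmless, so
      the unit acts as the identity on functions and not only on values.\<close>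
    then have "\<beta> \<in> extensional (carrier G)"
      by (simp add: char_group_def)
    then show "char_act G \<phi> \<one>\<^bsub>L\<^esub> \<beta> = \<beta>"
      by (auto simp: char_act_def \<phi>(2) extensional_def)
  qed (fact L)+
  \<comment> \<open>With finitely many characters and two group elements there are only finitely
    many 2-cochains, hence finitely many classes.\<close>
  have "finite (carrier (char_group K G))"
    using I.finite_char_group[OF G_fin torsion] .
  moreover have "finite (carrier L)"
    using L(1) by simp
  ultimately have "finite (carrier L \<times> carrier L \<rightarrow>\<^sub>E carrier (char_group K G))"
    by (intro finite_PiE) auto
  then have "finite (carrier (grp_Z2 L (char_group K G) (char_act G \<phi>)))"
    by (rule finite_subset[rotated]) (use C.grp_Z2_funcset in blast)
  then have "finite (carrier (grp_H2 L (char_group K G) (char_act G \<phi>)))"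
    by (simp add: grp_H2_def carrier_FactGroup)
  then show ?thesis
    using I.ext_H2_le[OF C.order_two_action_axioms refl _ schur] by blast
qed

end
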